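(* Let $n,m\ge 1$, let $p$ be a noncommutative $*$-polynomial in $m$ variables with constant term zero, let $t_1,\dots,t_m>0$ be real exponents, and let $j_1,\dots,j_m\in\{1,\dots,n\}$ (possibly with repetitions). Let $N$ be the set of $r\in\{1,\dots,n\}$ such that $j_i=r$ for some $i$ with $t_i$ not an integer, and let $D$ be any subset of $\{1,\dots,n\}\setminus N$ (for instance $D=\emptyset$). Call a tuple $(x_1,\dots,x_n)$ of bounded operators on a Hilbert space admissible if $x_r$ is self-adjoint for every $r\notin D$ and $x_r\geq 0$ for every $r\in N$ (no condition is imposed on $x_r$ for $r\in D$). If $$p\left(x_{j_{1}}^{t_{1}},\ldots,x_{j_{m}}^{t_{m}}\right)\geq0$$ for all admissible tuples of square complex matrices $x_1,\dots,x_n$ (of a common, arbitrary size), then the same inequality holds for all admissible tuples of bounded operators $x_1,\dots,x_n$ on an arbitrary Hilbert space.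
   Context: A noncommutative $*$-polynomial in variables $z_1,\dots,z_m$ is a complex polynomial in the noncommuting symbols $z_1,z_1^{*},\dots,z_m,z_m^{*}$; it is evaluated on operators in the obvious way. For matrices or operators, $y\ge0$ means positive semidefinite (in particular self-adjoint). For $x\ge 0$ and $t>0$, $x^t$ is defined by continuous functional calculus; for a positive integer $t$ and arbitrary $x$, $x^t$ is the usual power. *)

theory Defs
  imports
    "HOL-Analysis.Analysis"
    "HOL-Library.Poly_Mapping"
    "Jordan_Normal_Form.Spectral_Radius"
    "Jordan_Normal_Form.Schur_Decomposition"
begin

section \<open>Noncommutative *-polynomials\<close>

datatype letter = Var nat | VarStar nat

fun letter_index :: "letter \<Rightarrow> nat" where
  "letter_index (Var i) = i"
| "letter_index (VarStar i) = i"

text \<open>A *-polynomial is a finitely supported family of complex coefficients indexed by words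
  in the letters; the coefficient of the empty word is the constant term.\<close>

type_synonym star_poly = "letter list \<Rightarrow>\<^sub>0 complex"

text \<open>The variables are numbered from \<open>1\<close> to \<open>m\<close>.\<close>

definition star_poly_in :: "nat \<Rightarrow> star_poly \<Rightarrow> bool" where
  "star_poly_in m p \<longleftrightarrow> (\<forall>w \<in> Poly_Mapping.keys p. \<forall>l \<in> set w. letter_index l \<in> {1..m})"

definition constant_term :: "star_poly \<Rightarrow> complex" where
  "constant_term p = Poly_Mapping.lookup p []"

section \<open>Complex Hilbert spaces\<close>

text \<open>The inner product is linear in the first argument. The last axiom says that the norm
  of the underlying real Banach space is the one induced by the inner product.\<close>

class complex_hilbert_space = banach +
  fixes scaleC :: "complex \<Rightarrow> 'a \<Rightarrow> 'a"
    and cinner :: "'a \<Rightarrow> 'a \<Rightarrow> complex"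
  assumes scaleC_of_real: "scaleC (complex_of_real r) v = r *\<^sub>R v"
    and scaleC_add_right: "scaleC a (v + w) = scaleC a v + scaleC a w"
    and scaleC_add_left: "scaleC (a + b) v = scaleC a v + scaleC b v"
    and scaleC_scaleC: "scaleC a (scaleC b v) = scaleC (a * b) v"
    and cinner_commute: "cinner v w = cnj (cinner w v)"
    and cinner_add_left: "cinner (u + v) w = cinner u w + cinner v w"
    and cinner_scaleC_left: "cinner (scaleC a v) w = a * cinner v w"
    and cinner_self: "cinner v v = complex_of_real ((norm v)\<^sup>2)"

instantiation complex :: complex_hilbert_space
begin

definition scaleC_complex :: "complex \<Rightarrow> complex \<Rightarrow> complex" where
  "scaleC_complex a z = a * z"

definition cinner_complex :: "complex \<Rightarrow> complex \<Rightarrow> complex" where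
  "cinner_complex z w = z * cnj w"

instance
  by standard
    (simp_all add: scaleC_complex_def cinner_complex_def scaleR_conv_of_real algebra_simps
      complex_norm_square[symmetric])

end

section \<open>Bounded operators\<close>

definition bounded_clinear :: "('h::complex_hilbert_space \<Rightarrow> 'h) \<Rightarrow> bool" where
  "bounded_clinear f \<longleftrightarrow> bounded_linear f \<and> (\<forall>c v. f (scaleC c v) = scaleC c (f v))"

definition op_adjoint :: "('h::complex_hilbert_space \<Rightarrow> 'h) \<Rightarrow> 'h \<Rightarrow> 'h" where
  "op_adjoint f = (THE g. \<forall>v w. cinner (f v) w = cinner v (g w))"

definition op_selfadjoint :: "('h::complex_hilbert_space \<Rightarrow> 'h) \<Rightarrow> bool" where
  "op_selfadjoint f \<longleftrightarrow> (\<forall>v w. cinner (f v) w = cinner v (f w))"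

definition op_nonneg :: "('h::complex_hilbert_space \<Rightarrow> 'h) \<Rightarrow> bool" where
  "op_nonneg f \<longleftrightarrow> op_selfadjoint f \<and> (\<forall>v. 0 \<le> Re (cinner (f v) v))"

definition op_spectrum :: "('h::complex_hilbert_space \<Rightarrow> 'h) \<Rightarrow> complex set" where
  "op_spectrum f = {z. \<not> (\<exists>g. bounded_clinear g \<and>
     (\<forall>v. g (scaleC z v - f v) = v) \<and> (\<forall>v. scaleC z (g v) - f (g v) = v))}"

definition op_poly :: "real poly \<Rightarrow> ('h::complex_hilbert_space \<Rightarrow> 'h) \<Rightarrow> 'h \<Rightarrow> 'h" where
  "op_poly q f v = (\<Sum>i\<le>degree q. coeff q i *\<^sub>R (f ^^ i) v)"

text \<open>Continuous functional calculus of a self-adjoint operator (whose spectrum is real) for a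
  real function that is continuous on the spectrum: the norm limit of \<open>q\<^sub>l(f)\<close> for polynomials
  \<open>q\<^sub>l\<close> converging to the function uniformly on the spectrum.\<close>

definition op_cfc :: "(real \<Rightarrow> real) \<Rightarrow> ('h::complex_hilbert_space \<Rightarrow> 'h) \<Rightarrow> 'h \<Rightarrow> 'h" where
  "op_cfc h f = (THE g. bounded_clinear g \<and> (\<exists>q :: nat \<Rightarrow> real poly.
     uniform_limit {s. complex_of_real s \<in> op_spectrum f} (\<lambda>l. poly (q l)) h sequentially \<and>
     (\<lambda>l. onorm (\<lambda>v. op_poly (q l) f v - g v)) \<longlonglongrightarrow> 0))"

text \<open>For \<open>t > 0\<close>. On nonnegative operators the two cases agree when \<open>t\<close> is an integer.
  Note that \<open>0 powr t = 0\<close>, so the function is continuous on the nonnegative half-line.\<close>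

definition op_power :: "('h::complex_hilbert_space \<Rightarrow> 'h) \<Rightarrow> real \<Rightarrow> 'h \<Rightarrow> 'h" where
  "op_power f t = (if t \<in> \<int> then f ^^ nat \<lfloor>t\<rfloor> else op_cfc (\<lambda>s. s powr t) f)"

fun op_letter :: "(nat \<Rightarrow> 'h::complex_hilbert_space \<Rightarrow> 'h) \<Rightarrow> letter \<Rightarrow> 'h \<Rightarrow> 'h" where
  "op_letter y (Var i) = y i"
| "op_letter y (VarStar i) = op_adjoint (y i)"

fun op_word :: "(nat \<Rightarrow> 'h::complex_hilbert_space \<Rightarrow> 'h) \<Rightarrow> letter list \<Rightarrow> 'h \<Rightarrow> 'h" where
  "op_word y [] = id"
| "op_word y (l # w) = op_letter y l \<circ> op_word y w"

definition op_eval :: "star_poly \<Rightarrow> (nat \<Rightarrow> 'h::complex_hilbert_space \<Rightarrow> 'h) \<Rightarrow> 'h \<Rightarrow> 'h" where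
  "op_eval p y v = (\<Sum>w \<in> Poly_Mapping.keys p. scaleC (Poly_Mapping.lookup p w) (op_word y w v))"

section \<open>Complex matrices\<close>

definition mat_selfadjoint :: "complex mat \<Rightarrow> bool" where
  "mat_selfadjoint A \<longleftrightarrow> mat_adjoint A = A"

definition mat_nonneg :: "nat \<Rightarrow> complex mat \<Rightarrow> bool" where
  "mat_nonneg k A \<longleftrightarrow> mat_selfadjoint A \<and> (\<forall>v \<in> carrier_vec k. 0 \<le> Re ((A *\<^sub>v v) \<bullet>c v))"

definition mat_poly :: "nat \<Rightarrow> real poly \<Rightarrow> complex mat \<Rightarrow> complex mat" where
  "mat_poly k q A = mat k k (\<lambda>(a, b).
     \<Sum>i\<le>degree q. complex_of_real (coeff q i) * (A ^\<^sub>m i) $$ (a, b))"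

text \<open>Entrywise convergence is norm convergence, the size being fixed.\<close>

definition mat_cfc :: "nat \<Rightarrow> (real \<Rightarrow> real) \<Rightarrow> complex mat \<Rightarrow> complex mat" where
  "mat_cfc k h A = (THE B. B \<in> carrier_mat k k \<and> (\<exists>q :: nat \<Rightarrow> real poly.
     uniform_limit {s. complex_of_real s \<in> spectrum A} (\<lambda>l. poly (q l)) h sequentially \<and>
     (\<forall>a<k. \<forall>b<k. (\<lambda>l. mat_poly k (q l) A $$ (a, b)) \<longlonglongrightarrow> B $$ (a, b))))"

definition mat_power :: "nat \<Rightarrow> complex mat \<Rightarrow> real \<Rightarrow> complex mat" where
  "mat_power k A t = (if t \<in> \<int> then A ^\<^sub>m nat \<lfloor>t\<rfloor> else mat_cfc k (\<lambda>s. s powr t) A)"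

fun mat_letter :: "(nat \<Rightarrow> complex mat) \<Rightarrow> letter \<Rightarrow> complex mat" where
  "mat_letter Y (Var i) = Y i"
| "mat_letter Y (VarStar i) = mat_adjoint (Y i)"

fun mat_word :: "nat \<Rightarrow> (nat \<Rightarrow> complex mat) \<Rightarrow> letter list \<Rightarrow> complex mat" where
  "mat_word k Y [] = 1\<^sub>m k"
| "mat_word k Y (l # w) = mat_letter Y l * mat_word k Y w"

definition mat_eval :: "nat \<Rightarrow> star_poly \<Rightarrow> (nat \<Rightarrow> complex mat) \<Rightarrow> complex mat" where
  "mat_eval k p Y = mat k k (\<lambda>(a, b). \<Sum>w \<in> Poly_Mapping.keys p. Poly_Mapping.lookup p w * mat_word k Y w $$ (a, b))"

section \<open>Admissible tuples\<close>

text \<open>Only the entries with index in \<open>{1..n}\<close> belong to the tuple.\<close>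

definition admissible_op ::
  "nat \<Rightarrow> nat set \<Rightarrow> nat set \<Rightarrow> (nat \<Rightarrow> 'h::complex_hilbert_space \<Rightarrow> 'h) \<Rightarrow> bool" where
  "admissible_op n N D x \<longleftrightarrow>
     (\<forall>r \<in> {1..n}. bounded_clinear (x r)) \<and>
     (\<forall>r \<in> {1..n} - D. op_selfadjoint (x r)) \<and>
     (\<forall>r \<in> N. op_nonneg (x r))"

definition admissible_mat ::
  "nat \<Rightarrow> nat set \<Rightarrow> nat set \<Rightarrow> nat \<Rightarrow> (nat \<Rightarrow> complex mat) \<Rightarrow> bool" where
  "admissible_mat n N D k X \<longleftrightarrow>
     (\<forall>r \<in> {1..n}. X r \<in> carrier_mat k k) \<and>
     (\<forall>r \<in> {1..n} - D. mat_selfadjoint (X r)) \<and>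
     (\<forall>r \<in> N. mat_nonneg k (X r))"

end

theory Submission
  imports Defs
begin

text \<open>
  Positivity only has to be tested on one vector \<open>v\<close> at a time. Compress the operators \<open>x\<^sub>r\<close> to
  finite-dimensional subspaces containing longer and longer words in the \<open>x\<^sub>r\<close> and their adjoints,
  applied to the finitely many vectors obtained from \<open>v\<close> by short words in the powers
  \<open>x\<^bsub>j\<^sub>i\<^esub>\<^bsup>t\<^sub>i\<^esup>\<close>. On these vectors a polynomial of bounded degree in a compression agrees with the
  polynomial in the operator, and real powers are, uniformly on nonnegative operators of norm at
  most \<open>R\<close>, limits of polynomials (the spectral norm bound for self-adjoint operators). Hence the
  powers of the compressions are bounded and converge strongly on the relevant vectors, so
  \<open>\<langle>p(\<dots>)v, v\<rangle>\<close> is a limit of the corresponding nonnegative numbers for matrices.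
\<close>

section \<open>Elementary Hilbert space geometry\<close>

text \<open>Compression is not multiplicative, and the \<open>x r\<close> need have no common
  finite-dimensional invariant subspace, so operators and compressions can be made to agree only
  along finitely many orbits at a time. The frame therefore depends on \<open>v\<close>, and each
  limit speaks of that \<open>v\<close> alone; self-adjointness of the evaluated polynomial has to
  be recovered afterwards from the reality of its quadratic form. Strong convergence by itself
  passes neither to products nor to adjoints. Products are handled by norm bounds independent of the
  frame, adjoints by putting the orbits of the adjoints into the frame as well, which matters for
  \<open>r\<close> in \<open>D\<close>. \<open>op_adjoint\<close>, \<open>op_cfc\<close> and
  \<open>mat_cfc\<close> are definite descriptions, so each is usable only after existence and
  uniqueness have been shown. For both calculi the source is the estimate
  \<open>norm_op_poly_le\<close>, obtained by factoring a polynomial over the complex numbers,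
  without a spectral theorem.\<close>

lemma scaleC_one [simp]: "scaleC 1 (v::'h::complex_hilbert_space) = v"
  using scaleC_of_real[of 1 v] by simp

lemma scaleC_zero_left [simp]: "scaleC 0 (v::'h::complex_hilbert_space) = 0"
  using scaleC_of_real[of 0 v] by simp

lemma scaleC_zero_right [simp]: "scaleC c (0::'h::complex_hilbert_space) = 0"
  using scaleC_add_right[of c 0 0] by simp

lemma scaleC_minus_right: "scaleC c (- (v::'h::complex_hilbert_space)) = - scaleC c v"
  using scaleC_add_right[of c v "- v"] by (simp add: eq_neg_iff_add_eq_0 add.commute)

lemma scaleC_diff_right: "scaleC c (v - w) = scaleC c (v::'h::complex_hilbert_space) - scaleC c w"
  using scaleC_add_right[of c v "- w"] by (simp add: scaleC_minus_right)

lemma scaleC_minus_left: "scaleC (- c) (v::'h::complex_hilbert_space) = - scaleC c v"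
  using scaleC_add_left[of c "- c" v] by (simp add: eq_neg_iff_add_eq_0 add.commute)

lemma scaleC_diff_left: "scaleC (c - d) (v::'h::complex_hilbert_space) = scaleC c v - scaleC d v"
  using scaleC_add_left[of c "- d" v] by (simp add: scaleC_minus_left)

lemma scaleC_sum_right: "scaleC c (\<Sum>i\<in>I. f i) = (\<Sum>i\<in>I. scaleC c (f i :: 'h::complex_hilbert_space))"
  by (induction I rule: infinite_finite_induct) (simp_all add: scaleC_add_right)

lemma scaleC_sum_left: "scaleC (\<Sum>i\<in>I. f i) v = (\<Sum>i\<in>I. scaleC (f i) (v :: 'h::complex_hilbert_space))"
  by (induction I rule: infinite_finite_induct) (simp_all add: scaleC_add_left)

lemma cinner_add_right: "cinner u (v + w) = cinner u v + cinner (u::'h::complex_hilbert_space) w"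
  by (metis cinner_add_left cinner_commute complex_cnj_add)

lemma cinner_scaleC_right: "cinner v (scaleC a w) = cnj a * cinner (v::'h::complex_hilbert_space) w"
  by (metis cinner_scaleC_left cinner_commute complex_cnj_mult)

lemma cinner_zero_left [simp]: "cinner 0 (v::'h::complex_hilbert_space) = 0"
  using cinner_add_left[of 0 0 v] by simp

lemma cinner_zero_right [simp]: "cinner (v::'h::complex_hilbert_space) 0 = 0"
  using cinner_add_right[of v 0 0] by simp

lemma cinner_minus_left: "cinner (- v) (w::'h::complex_hilbert_space) = - cinner v w"
  using cinner_add_left[of v "- v" w] by (simp add: eq_neg_iff_add_eq_0 add.commute)

lemma cinner_minus_right: "cinner (v::'h::complex_hilbert_space) (- w) = - cinner v w"
  using cinner_add_right[of v w "- w"] by (simp add: eq_neg_iff_add_eq_0 add.commute)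

lemma cinner_diff_left: "cinner (u - v) (w::'h::complex_hilbert_space) = cinner u w - cinner v w"
  using cinner_add_left[of u "- v" w] by (simp add: cinner_minus_left)

lemma cinner_diff_right: "cinner (w::'h::complex_hilbert_space) (u - v) = cinner w u - cinner w v"
  using cinner_add_right[of w u "- v"] by (simp add: cinner_minus_right)

lemma cinner_sum_left: "cinner (\<Sum>i\<in>I. f i) v = (\<Sum>i\<in>I. cinner (f i) (v::'h::complex_hilbert_space))"
  by (induction I rule: infinite_finite_induct) (simp_all add: cinner_add_left)

lemma cinner_sum_right: "cinner v (\<Sum>i\<in>I. f i) = (\<Sum>i\<in>I. cinner (v::'h::complex_hilbert_space) (f i))"
  by (induction I rule: infinite_finite_induct) (simp_all add: cinner_add_right)

lemma cinner_scaleR_left: "cinner (r *\<^sub>R v) w = complex_of_real r * cinner (v::'h::complex_hilbert_space) w"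
  by (metis cinner_scaleC_left scaleC_of_real)

lemma cinner_scaleR_right: "cinner v (r *\<^sub>R w) = complex_of_real r * cinner (v::'h::complex_hilbert_space) w"
  by (metis cinner_scaleC_right complex_cnj_complex_of_real scaleC_of_real)

lemma norm_scaleC: "norm (scaleC c v) = cmod c * norm (v::'h::complex_hilbert_space)"
proof -
  have "complex_of_real ((norm (scaleC c v))\<^sup>2) = complex_of_real ((cmod c * norm v)\<^sup>2)"
    unfolding cinner_self[symmetric] cinner_scaleC_left cinner_scaleC_right
    by (simp add: cinner_self power_mult_distrib complex_norm_square[simplified] mult_ac)
  then have "(norm (scaleC c v))\<^sup>2 = (cmod c * norm v)\<^sup>2" by (simp only: of_real_eq_iff)
  then show ?thesis by simp
qed

lemma norm_add_sq:
  "(norm (v + w))\<^sup>2 = (norm v)\<^sup>2 + 2 * Re (cinner v w) + (norm (w::'h::complex_hilbert_space))\<^sup>2"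
proof -
  have "complex_of_real ((norm (v + w))\<^sup>2)
      = complex_of_real ((norm v)\<^sup>2) + (cinner v w + cnj (cinner v w)) + complex_of_real ((norm w)\<^sup>2)"
    by (simp only: cinner_self[symmetric] cinner_add_left cinner_add_right cinner_commute[of w v, symmetric])
       (simp add: algebra_simps cinner_commute[of w v])
  then have "Re (complex_of_real ((norm (v + w))\<^sup>2))
      = Re (complex_of_real ((norm v)\<^sup>2) + (cinner v w + cnj (cinner v w)) + complex_of_real ((norm w)\<^sup>2))"
    by simp
  then show ?thesis by simp
qed

lemma norm_diff_sq:
  "(norm (v - w))\<^sup>2 = (norm v)\<^sup>2 - 2 * Re (cinner v w) + (norm (w::'h::complex_hilbert_space))\<^sup>2"
  using norm_add_sq[of v "- w"] by (simp add: cinner_minus_right)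

lemma cinner_ext:
  assumes "\<And>w. cinner w u = cinner w (v::'h::complex_hilbert_space)" shows "u = v"
proof -
  have "cinner (u - v) (u - v) = 0"
    using assms by (simp add: cinner_diff_right)
  then show ?thesis by (simp add: cinner_self)
qed

section \<open>Bounded operators\<close>

lemma bounded_clinear_linear: "bounded_clinear f \<Longrightarrow> bounded_linear f"
  by (simp add: bounded_clinear_def)

lemma bounded_clinear_add: "bounded_clinear f \<Longrightarrow> f (v + w) = f v + f w"
  by (simp add: bounded_clinear_def linear_simps)

lemma bounded_clinear_diff: "bounded_clinear f \<Longrightarrow> f (v - w) = f v - f w"
  by (simp add: bounded_clinear_def linear_simps)

lemma bounded_clinear_zero: "bounded_clinear f \<Longrightarrow> f 0 = 0"
  by (simp add: bounded_clinear_def linear_simps)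

lemma bounded_clinear_scaleC: "bounded_clinear f \<Longrightarrow> f (scaleC c v) = scaleC c (f v)"
  by (simp add: bounded_clinear_def)

lemma bounded_clinear_scaleR: "bounded_clinear f \<Longrightarrow> f (r *\<^sub>R v) = r *\<^sub>R f v"
  by (simp add: bounded_clinear_def linear_simps)

lemma bounded_clinear_sum: "bounded_clinear f \<Longrightarrow> f (\<Sum>i\<in>I. g i) = (\<Sum>i\<in>I. f (g i))"
  by (simp add: bounded_clinear_def bounded_linear.linear linear_sum)

lemmas bounded_clinear_simps = bounded_clinear_add bounded_clinear_diff bounded_clinear_zero
  bounded_clinear_scaleC bounded_clinear_scaleR bounded_clinear_sum

lemma bounded_clinearI:
  assumes "\<And>v w. f (v + w) = f v + f w" "\<And>c v. f (scaleC c v) = scaleC c (f v)"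
    and "\<And>v. norm (f v) \<le> B * norm v"
  shows "bounded_clinear f"
  unfolding bounded_clinear_def
proof
  show "bounded_linear f"
  proof (rule bounded_linear_intro)
    show "f (r *\<^sub>R v) = r *\<^sub>R f v" for r v
      by (metis assms(2) scaleC_of_real)
    show "norm (f v) \<le> norm v * B" for v using assms(3) by (simp add: mult.commute)
  qed (rule assms)
qed (simp add: assms)

lemma bounded_clinear_bound:
  assumes "bounded_clinear f"
  obtains B where "0 \<le> B" "\<And>v. norm (f v) \<le> B * norm v"
  using bounded_linear.nonneg_bounded[OF bounded_clinear_linear[OF assms]]
  by (metis mult.commute)

lemma bounded_clinear_id [simp]: "bounded_clinear (\<lambda>v. v)"
  by (rule bounded_clinearI[of _ 1]) auto

lemma bounded_clinear_0 [simp]: "bounded_clinear (\<lambda>v. 0)"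
  by (rule bounded_clinearI[of _ 0]) auto

lemma bounded_clinear_compose:
  "bounded_clinear f \<Longrightarrow> bounded_clinear g \<Longrightarrow> bounded_clinear (\<lambda>v. f (g v))"
  unfolding bounded_clinear_def using bounded_linear_compose by auto

lemma bounded_clinear_plus:
  "bounded_clinear f \<Longrightarrow> bounded_clinear g \<Longrightarrow> bounded_clinear (\<lambda>v. f v + g v)"
  unfolding bounded_clinear_def using bounded_linear_add by (auto simp: scaleC_add_right)

lemma bounded_clinear_minus:
  "bounded_clinear f \<Longrightarrow> bounded_clinear g \<Longrightarrow> bounded_clinear (\<lambda>v. f v - g v)"
  unfolding bounded_clinear_def using bounded_linear_sub by (auto simp: scaleC_diff_right)

lemma bounded_clinear_const_scaleC:
  assumes "bounded_clinear f" shows "bounded_clinear (\<lambda>v. scaleC c (f v))"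
proof -
  obtain B where B: "0 \<le> B" "\<And>v. norm (f v) \<le> B * norm v"
    using bounded_clinear_bound[OF assms] by blast
  show ?thesis
  proof (rule bounded_clinearI)
    show "norm (scaleC c (f v)) \<le> cmod c * B * norm v" for v
      using mult_left_mono[OF B(2)[of v], of "cmod c"] by (simp add: norm_scaleC mult.assoc)
  qed (simp_all add: assms bounded_clinear_simps scaleC_add_right scaleC_scaleC mult.commute)
qed

lemma bounded_clinear_const_scaleR:
  assumes "bounded_clinear f" shows "bounded_clinear (\<lambda>v. r *\<^sub>R f v)"
  using bounded_clinear_const_scaleC[OF assms, of "complex_of_real r"] by (simp add: scaleC_of_real)

lemma bounded_clinear_setsum:
  "(\<And>i. i \<in> I \<Longrightarrow> bounded_clinear (f i)) \<Longrightarrow> bounded_clinear (\<lambda>v. \<Sum>i\<in>I. f i v)"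
  by (induction I rule: infinite_finite_induct) (simp_all add: bounded_clinear_plus)

lemma bounded_clinear_funpow: "bounded_clinear f \<Longrightarrow> bounded_clinear (f ^^ i)"
proof (induction i)
  case 0
  then show ?case using bounded_clinear_id by (simp add: id_def)
next
  case (Suc i)
  then show ?case using bounded_clinear_compose[of f "f ^^ i"] by (simp add: o_def)
qed

lemma bounded_clinear_op_poly: "bounded_clinear f \<Longrightarrow> bounded_clinear (op_poly q f)"
  unfolding op_poly_def
  by (intro bounded_clinear_setsum bounded_clinear_const_scaleR bounded_clinear_funpow)

text \<open>The form of \<open>f\<close> is evaluated at \<open>s v - z w\<close> with real
  \<open>s\<close>; the factor \<open>z\<close> absorbs the phase and leaves a real quadratic
  polynomial. The form may degenerate, hence the separate case \<open>a = 0\<close>. The identity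
  gives the ordinary inequality; general \<open>f\<close> is needed to locate the spectrum.\<close>

lemma op_nonneg_Cauchy_Schwarz:
  assumes f: "bounded_clinear f" and pos: "op_nonneg f"
  shows "(cmod (cinner (f v) w))\<^sup>2 \<le> Re (cinner (f v) v) * Re (cinner (f w) w)"
proof -
  define z where "z = cinner (f v) w"
  define a where "a = Re (cinner (f v) v)"
  define b where "b = Re (cinner (f w) w)"
  have ab: "0 \<le> a" "0 \<le> b" using pos by (auto simp: op_nonneg_def a_def b_def)
  have wv: "cinner (f w) v = cnj z"
    using pos unfolding op_nonneg_def op_selfadjoint_def z_def by (metis cinner_commute)
  have quad: "0 \<le> a * s\<^sup>2 - 2 * s * (cmod z)\<^sup>2 + (cmod z)\<^sup>2 * b" for s :: real
  proof -
    define u where "u = s *\<^sub>R v - scaleC z w"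
    have "0 \<le> Re (cinner (f u) u)" using pos by (simp add: op_nonneg_def)
    also have "cinner (f u) u = s * s * cinner (f v) v - s * (cnj z * z) - s * (z * cnj z) + z * cnj z * cinner (f w) w"
      unfolding u_def
      by (simp add: bounded_clinear_simps[OF f] cinner_diff_left cinner_diff_right cinner_scaleR_left
         cinner_scaleR_right cinner_scaleC_left cinner_scaleC_right wv z_def[symmetric] algebra_simps)
    also have "Re \<dots> = a * s\<^sup>2 - 2 * s * (cmod z)\<^sup>2 + (cmod z)\<^sup>2 * b"
      unfolding a_def b_def cmod_power2 by (simp add: power2_eq_square algebra_simps)
    finally show ?thesis .
  qed
  show ?thesis
  proof (cases "z = 0")
    case True
    then show ?thesis using ab by (simp add: z_def a_def b_def)
  next
    case False
    then have z: "0 < (cmod z)\<^sup>2" by simp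
    show ?thesis
    proof (cases "a = 0")
      case True
      \<comment> \<open>For \<open>a = 0\<close> the polynomial is affine in \<open>s\<close>, and
        this \<open>s\<close> gives it the value \<open>- (cmod z)^2\<close>.\<close>
      have "0 \<le> - (cmod z)\<^sup>2" using quad[of "(b+1)/2"] True by (simp add: algebra_simps)
      then show ?thesis using z by simp
    next
      case False
      \<comment> \<open>The value of \<open>s\<close> is the minimiser of the quadratic
        polynomial.\<close>
      have "0 \<le> a * ((cmod z)\<^sup>2 / a)\<^sup>2 - 2 * ((cmod z)\<^sup>2 / a) * (cmod z)\<^sup>2 + (cmod z)\<^sup>2 * b"
        by (rule quad)
      also have "\<dots> = (cmod z)\<^sup>2 * (a * b - (cmod z)\<^sup>2) / a"
        using False by (simp add: field_simps power2_eq_square)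
      finally show ?thesis using z False ab
        by (simp add: zero_le_divide_iff zero_le_mult_iff z_def[symmetric] a_def b_def)
    qed
  qed
qed

lemma cinner_Cauchy_Schwarz: "cmod (cinner v w) \<le> norm v * norm (w::'h::complex_hilbert_space)"
proof -
  have "op_nonneg (\<lambda>v::'h. v)" by (simp add: op_nonneg_def op_selfadjoint_def cinner_self)
  from op_nonneg_Cauchy_Schwarz[OF bounded_clinear_id this, of v w]
  have "(cmod (cinner v w))\<^sup>2 \<le> (norm v * norm w)\<^sup>2" by (simp add: cinner_self power_mult_distrib)
  then show ?thesis by (rule power2_le_imp_le) simp
qed

lemma tendsto_cinner:
  fixes f g :: "'b \<Rightarrow> 'h::complex_hilbert_space"
  assumes f: "(f \<longlongrightarrow> v) F" and g: "(g \<longlongrightarrow> w) F"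
  shows "((\<lambda>x. cinner (f x) (g x)) \<longlongrightarrow> cinner v w) F"
proof -
  interpret bounded_bilinear "cinner :: 'h \<Rightarrow> 'h \<Rightarrow> complex"
    by standard (auto simp: cinner_add_left cinner_add_right cinner_scaleR_left cinner_scaleR_right
        scaleR_conv_of_real intro!: exI[of _ 1] cinner_Cauchy_Schwarz)
  show ?thesis by (rule tendsto[OF f g])
qed

lemma tendsto_scaleC:
  "(f \<longlongrightarrow> v) F \<Longrightarrow> ((\<lambda>x. scaleC c (f x)) \<longlongrightarrow> scaleC c (v::'h::complex_hilbert_space)) F"
  using bounded_linear.tendsto[OF bounded_clinear_linear[OF bounded_clinear_const_scaleC[OF bounded_clinear_id]]]
  by blast

section \<open>Adjoints\<close>

text \<open>The representing vector minimises \<open>\<parallel>v\<parallel>\<^sup>2 - 2 Re \<phi>(v)\<close>; minimising sequences are Cauchy by the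
  parallelogram law.\<close>

lemma Riesz_representation:
  fixes \<phi> :: "'h::complex_hilbert_space \<Rightarrow> complex"
  assumes lin: "bounded_linear \<phi>" and sc: "\<And>c v. \<phi> (scaleC c v) = c * \<phi> v"
  obtains g where "\<And>v. \<phi> v = cinner v g"
proof -
  interpret bounded_linear \<phi> by (rule lin)
  obtain C where C: "\<And>v. cmod (\<phi> v) \<le> norm v * C" using bounded by blast
  define J where "J v = (norm v)\<^sup>2 - 2 * Re (\<phi> v)" for v
  have Jlow: "- C\<^sup>2 \<le> J v" for v
  proof -
    have "Re (\<phi> v) \<le> norm v * C" using C[of v] complex_Re_le_cmod[of "\<phi> v"] by linarith
    moreover have "0 \<le> (norm v - C)\<^sup>2" by simp
    ultimately show ?thesis by (simp add: J_def power2_eq_square algebra_simps)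
  qed
  define m where "m = Inf (range J)"
  have bdd: "bdd_below (range J)" using Jlow by (auto intro!: bdd_belowI2)
  have mle: "m \<le> J v" for v unfolding m_def using bdd by (auto intro: cInf_lower)
  have "\<exists>v. J v < m + inverse (Suc i)" for i
    using cInf_lessD[of "range J" "m + inverse (Suc i)"] by (auto simp: m_def)
  then obtain V where V: "\<And>i::nat. J (V i) < m + inverse (Suc i)" by metis
  have par: "(norm (v - w))\<^sup>2 \<le> 2 * (J v - m) + 2 * (J w - m)" for v w
  proof -
    have "(norm (v - w))\<^sup>2 = 2 * J v + 2 * J w - 4 * J ((1/2) *\<^sub>R (v + w))"
      by (simp add: J_def norm_diff_sq norm_add_sq scaleR add power_divide power_mult_distrib
          cinner_scaleR_left cinner_scaleR_right field_simps del: scaleR_add_right)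
    then show ?thesis using mle[of "(1/2) *\<^sub>R (v + w)"] by simp
  qed
  have "Cauchy V"
  proof (rule metric_CauchyI)
    fix e :: real assume "0 < e"
    then obtain M where M: "inverse (Suc M) < e\<^sup>2 / 4"
      using reals_Archimedean[of "e\<^sup>2/4"] by auto
    have "dist (V a) (V b) < e" if "a \<ge> M" "b \<ge> M" for a b
    proof -
      have "inverse (real (Suc a)) \<le> inverse (Suc M)" "inverse (real (Suc b)) \<le> inverse (Suc M)"
        using that by (auto simp: field_simps)
      then have "(norm (V a - V b))\<^sup>2 < e\<^sup>2"
        using par[of "V a" "V b"] V[of a] V[of b] M by argo
      then show ?thesis using \<open>0 < e\<close> by (simp add: dist_norm power_less_imp_less_base)
    qed
    then show "\<exists>M. \<forall>a\<ge>M. \<forall>b\<ge>M. dist (V a) (V b) < e" by blast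
  qed
  then obtain g where g: "V \<longlonglongrightarrow> g" using Cauchy_convergent convergent_def by blast
  have "(\<lambda>i. J (V i)) \<longlonglongrightarrow> J g"
    unfolding J_def by (intro tendsto_intros tendsto g)
  moreover have "(\<lambda>i. m + inverse (real (Suc i))) \<longlonglongrightarrow> m + 0"
    by (intro tendsto_intros LIMSEQ_inverse_real_of_nat)
  ultimately have "J g \<le> m + 0"
    by (rule LIMSEQ_le) (use V less_imp_le in blast)
  then have min: "J g \<le> J v" for v using mle[of v] by simp
  have re: "Re (\<phi> w) = Re (cinner w g)" for w
  proof (rule ccontr)
    define d where "d = Re (\<phi> w) - Re (cinner w g)"
    assume "Re (\<phi> w) \<noteq> Re (cinner w g)"
    then have d: "d \<noteq> 0" "w \<noteq> 0" by (auto simp: d_def zero)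
    \<comment> \<open>The minimiser of \<open>J\<close> along the line through \<open>g\<close> in
      direction \<open>w\<close>.\<close>
    define s where "s = d / (norm w)\<^sup>2"
    have "J (g + s *\<^sub>R w) = J g - 2 * s * d + s\<^sup>2 * (norm w)\<^sup>2"
      by (simp add: J_def norm_add_sq add scaleR cinner_scaleR_right cinner_commute[of g w] d_def
          algebra_simps power_mult_distrib)
    also have "\<dots> = J g - d\<^sup>2 / (norm w)\<^sup>2"
      using d by (simp add: s_def power2_eq_square field_simps)
    also have "\<dots> < J g" using d by simp
    finally show False using min[of "g + s *\<^sub>R w"] by simp
  qed
  have "\<phi> w = cinner w g" for w
  proof (rule complex_eqI)
    show "Re (\<phi> w) = Re (cinner w g)" by (rule re)
    show "Im (\<phi> w) = Im (cinner w g)"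
      using re[of "scaleC \<i> w"] by (simp add: sc cinner_scaleC_left)
  qed
  then show ?thesis using that by blast
qed

lemma op_adjoint_eqI:
  assumes "\<And>v w. cinner (f v) w = cinner v (g w)"
  shows "op_adjoint f = g"
  unfolding op_adjoint_def
proof (rule the_equality)
  show "g' = g" if "\<forall>v w. cinner (f v) w = cinner v (g' w)" for g'
    by (rule ext, rule cinner_ext) (use that assms in metis)
qed (use assms in blast)

text \<open>Riesz, applied to the functionals \<open>v \<mapsto> cinner (f v) w\<close>, supplies
  the function that the definite description asks for. The bound comes from
  \<open>(norm (g w))^2 = cmod (cinner (f (g w)) w)\<close> and keeps the constant of
  \<open>f\<close>, so starred and unstarred letters can share one bound.\<close>

lemma
  assumes f: "bounded_clinear f"
  shows op_adjoint: "cinner (f v) w = cinner v (op_adjoint f w)"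
    and bounded_clinear_op_adjoint: "bounded_clinear (op_adjoint f)"
    and norm_op_adjoint_le: "(\<And>v. norm (f v) \<le> B * norm v) \<Longrightarrow> norm (op_adjoint f w) \<le> B * norm w"
proof -
  have "\<exists>g. \<forall>v. cinner (f v) w = cinner v g" for w
  proof -
    obtain B where B: "0 \<le> B" "\<And>v. norm (f v) \<le> B * norm v"
      using bounded_clinear_bound[OF f] by blast
    have "bounded_linear (\<lambda>v. cinner (f v) w)"
    proof (rule bounded_linear_intro)
      show "cmod (cinner (f v) w) \<le> norm v * (B * norm w)" for v
        using cinner_Cauchy_Schwarz[of "f v" w] mult_right_mono[OF B(2)[of v], of "norm w"]
        by (simp add: mult_ac)
    qed (simp_all add: bounded_clinear_simps[OF f] cinner_add_left cinner_scaleR_left scaleR_conv_of_real)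
    from Riesz_representation[OF this] show ?thesis
      by (metis bounded_clinear_scaleC[OF f] cinner_scaleC_left)
  qed
  then obtain g where g: "\<And>v w. cinner (f v) w = cinner v (g w)" by metis
  have ad: "op_adjoint f = g" by (rule op_adjoint_eqI) (rule g)
  show "cinner (f v) w = cinner v (op_adjoint f w)" by (simp add: ad g)
  have bd: "norm (g w) \<le> B * norm w" if B: "\<And>v. norm (f v) \<le> B * norm v" for B w
  proof (cases "g w = 0")
    case True
    have "0 \<le> B * norm w" using order_trans[OF norm_ge_zero B] .
    then show ?thesis using True by simp
  next
    case False
    have "(norm (g w))\<^sup>2 = cmod (cinner (f (g w)) w)" by (simp add: g cinner_self del: of_real_power)
    also have "\<dots> \<le> B * norm (g w) * norm w"
      by (rule order_trans[OF cinner_Cauchy_Schwarz mult_right_mono[OF B]]) simp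
    finally show ?thesis using False by (simp add: power2_eq_square mult_ac)
  qed
  then show "norm (op_adjoint f w) \<le> B * norm w" if "\<And>v. norm (f v) \<le> B * norm v"
    using that by (simp add: ad)
  obtain B where B: "0 \<le> B" "\<And>v. norm (f v) \<le> B * norm v"
    using bounded_clinear_bound[OF f] by blast
  show "bounded_clinear (op_adjoint f)"
    unfolding ad
  proof (rule bounded_clinearI[of _ B])
    show "g (v + w) = g v + g w" for v w
      by (rule cinner_ext) (simp add: cinner_add_right g[symmetric])
    show "g (scaleC c v) = scaleC c (g v)" for c v
      by (rule cinner_ext) (simp add: cinner_scaleC_right g[symmetric])
  qed (use bd B in blast)
qed

lemma op_adjoint_selfadjoint: "op_selfadjoint f \<Longrightarrow> op_adjoint f = f"
  by (rule op_adjoint_eqI) (simp add: op_selfadjoint_def)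

lemma op_selfadjoint_funpow: "op_selfadjoint f \<Longrightarrow> op_selfadjoint (f ^^ i)"
  unfolding op_selfadjoint_def by (induction i) (simp, metis comp_apply funpow.simps(2) funpow_swap1)

lemma op_selfadjoint_op_poly: "op_selfadjoint f \<Longrightarrow> op_selfadjoint (op_poly q f)"
  using op_selfadjoint_funpow[of f]
  by (simp add: op_selfadjoint_def op_poly_def cinner_sum_left cinner_sum_right cinner_scaleR_left
      cinner_scaleR_right)

section \<open>Polynomials in an operator\<close>

text \<open>Complex coefficients are allowed because the norm bound splits a real polynomial into
  linear factors at its complex roots.\<close>

definition op_cpoly :: "complex poly \<Rightarrow> ('h::complex_hilbert_space \<Rightarrow> 'h) \<Rightarrow> 'h \<Rightarrow> 'h" where
  "op_cpoly q f v = (\<Sum>i\<le>degree q. scaleC (coeff q i) ((f ^^ i) v))"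

lemma op_poly_eq_op_cpoly: "op_poly q f v = op_cpoly (map_poly complex_of_real q) f v"
  by (simp add: op_poly_def op_cpoly_def coeff_map_poly scaleC_of_real)

lemma op_cpoly_0 [simp]: "op_cpoly 0 f v = 0"
  by (simp add: op_cpoly_def)

text \<open>Horner's recursion: it turns the algebra rules below into inductions over polynomials,
  with no bookkeeping of degrees.\<close>

lemma op_cpoly_pCons:
  assumes "bounded_clinear f"
  shows "op_cpoly (pCons a q) f v = scaleC a v + f (op_cpoly q f v)"
proof (cases "q = 0")
  case True
  then show ?thesis by (simp add: op_cpoly_def bounded_clinear_zero[OF assms])
next
  case False
  then show ?thesis
    by (simp add: op_cpoly_def sum.atMost_Suc_shift bounded_clinear_simps[OF assms] del: sum.atMost_Suc)
qed

lemma op_cpoly_add: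
  assumes "bounded_clinear f"
  shows "op_cpoly (p + q) f v = op_cpoly p f v + op_cpoly q f v"
  by (induction p q rule: poly_induct2)
    (simp_all add: op_cpoly_pCons[OF assms] bounded_clinear_simps[OF assms] scaleC_add_left)

lemma op_cpoly_smult:
  assumes "bounded_clinear f"
  shows "op_cpoly (Polynomial.smult c q) f v = scaleC c (op_cpoly q f v)"
  by (induction q)
    (simp_all add: op_cpoly_pCons[OF assms] bounded_clinear_simps[OF assms] scaleC_add_right scaleC_scaleC)

lemma op_cpoly_mult:
  assumes "bounded_clinear f"
  shows "op_cpoly (p * q) f v = op_cpoly p f (op_cpoly q f v)"
  by (induction p)
    (simp_all add: op_cpoly_pCons[OF assms] op_cpoly_add[OF assms] op_cpoly_smult[OF assms])

lemma op_poly_add: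
  "bounded_clinear f \<Longrightarrow> op_poly (p + q) f v = op_poly p f v + op_poly q f v"
  by (simp add: op_poly_eq_op_cpoly of_real_hom.map_poly_hom_add op_cpoly_add)

lemma op_poly_mult:
  assumes "bounded_clinear f"
  shows "op_poly (p * q) f v = op_poly p f (op_poly q f v)"
proof -
  interpret map_poly_comm_ring_hom complex_of_real ..
  show ?thesis by (simp add: op_poly_eq_op_cpoly hom_mult op_cpoly_mult[OF assms])
qed

lemma op_poly_smult:
  "op_poly (Polynomial.smult c q) f v = c *\<^sub>R op_poly q f v"
  by (simp add: op_poly_def scaleR_sum_right)

lemma op_poly_diff:
  "bounded_clinear f \<Longrightarrow> op_poly (p - q) f v = op_poly p f v - op_poly q f v"
  using op_poly_add[of f p "- q" v] op_poly_smult[of "-1" q f v] by simp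

lemma op_poly_const [simp]: "op_poly [:c:] f v = c *\<^sub>R v"
  by (simp add: op_poly_def)

section \<open>The spectral norm bound\<close>

text \<open>A composition of operators bounded below is bounded below, so roots can be split off one
  at a time. Lower bounds are used rather than inverses because a self-adjoint \<open>f\<close>
  delivers them immediately at non-real roots.\<close>

lemma op_cpoly_bounded_below:
  assumes f: "bounded_clinear f" and "r \<noteq> 0"
    and "\<And>\<mu>. poly r \<mu> = 0 \<Longrightarrow> \<exists>c>0. \<forall>v. c * norm v \<le> norm (f v - scaleC \<mu> v)"
  shows "\<exists>c>0. \<forall>v. c * norm v \<le> norm (op_cpoly r f v)"
  using assms(2,3)
proof (induction "degree r" arbitrary: r)
  case 0
  then obtain a where r: "r = [:a:]" "a \<noteq> 0" by (metis degree_eq_zeroE pCons_0_0)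
  then show ?case
    by (intro exI[of _ "cmod a"]) (simp add: op_cpoly_def norm_scaleC)
next
  case (Suc d)
  obtain \<mu> where \<mu>: "poly r \<mu> = 0"
    using fundamental_theorem_of_algebra[of r] Suc.hyps(2) by (auto simp: constant_degree)
  then obtain r' where r: "r = [:- \<mu>, 1:] * r'" by (auto simp: poly_eq_0_iff_dvd)
  have r0: "r' \<noteq> 0" using Suc.prems(1) r by auto
  then have "degree r = Suc (degree r')" unfolding r by (subst degree_mult_eq) auto
  then have "d = degree r'" using Suc.hyps(2) by simp
  from Suc.hyps(1)[OF this r0] Suc.prems(2) r
  obtain c where c: "c > 0" "\<And>v. c * norm v \<le> norm (op_cpoly r' f v)" by auto
  from Suc.prems(2)[OF \<mu>] obtain b where b: "b > 0" "\<And>v. b * norm v \<le> norm (f v - scaleC \<mu> v)" by blast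
  have "b * c * norm v \<le> norm (op_cpoly r f v)" for v
  proof -
    have "b * c * norm v \<le> b * norm (op_cpoly r' f v)"
      using c(2)[of v] b(1) by (simp add: mult.assoc)
    also have "\<dots> \<le> norm (f (op_cpoly r' f v) - scaleC \<mu> (op_cpoly r' f v))" by (rule b)
    also have "f (op_cpoly r' f v) - scaleC \<mu> (op_cpoly r' f v) = op_cpoly r f v"
      unfolding r op_cpoly_mult[OF f] op_cpoly_pCons[OF f]
      by (simp add: op_cpoly_def bounded_clinear_zero[OF f] scaleC_minus_left)
    finally show ?thesis .
  qed
  then show ?case using b c by (intro exI[of _ "b * c"]) simp
qed

lemma op_selfadjoint_cinner_real:
  assumes "op_selfadjoint f" shows "cinner (f v) v \<in> \<real>"
  using assms unfolding op_selfadjoint_def by (metis Reals_cnj_iff cinner_commute)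

text \<open>Since \<open>cinner (f v) v\<close> is real, \<open>Im \<mu>\<close> alone determines
  the imaginary part of \<open>cinner (f v - scaleC \<mu> v) v\<close>, and Cauchy-Schwarz bounds
  that part from above.\<close>

lemma op_selfadjoint_bounded_below:
  assumes f: "op_selfadjoint f"
  shows "\<bar>Im \<mu>\<bar> * norm v \<le> norm (f v - scaleC \<mu> v)"
proof (cases "v = 0")
  case False
  have "Im (cinner (f v - scaleC \<mu> v) v) = - Im \<mu> * (norm v)\<^sup>2"
    using op_selfadjoint_cinner_real[OF f, of v]
    by (simp add: cinner_diff_left cinner_scaleC_left cinner_self complex_is_Real_iff del: of_real_power)
  then have "\<bar>Im \<mu>\<bar> * (norm v)\<^sup>2 = \<bar>Im (cinner (f v - scaleC \<mu> v) v)\<bar>" by (simp add: abs_mult)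
  also have "\<dots> \<le> norm (f v - scaleC \<mu> v) * norm v"
    by (rule order_trans[OF abs_Im_le_cmod cinner_Cauchy_Schwarz])
  finally show ?thesis using False by (simp add: power2_eq_square mult.assoc[symmetric])
qed (simp add: op_selfadjoint_def)

lemma bounded_below_not_in_op_spectrum:
  assumes "z \<notin> op_spectrum f"
  shows "\<exists>c>0. \<forall>v. c * norm v \<le> norm (f v - scaleC z v)"
proof -
  from assms obtain g where g: "bounded_clinear g" "\<And>v. g (scaleC z v - f v) = v"
    by (auto simp: op_spectrum_def)
  obtain B where B: "0 \<le> B" "\<And>v. norm (g v) \<le> B * norm v" using bounded_clinear_bound[OF g(1)] by blast
  \<comment> \<open>\<open>B\<close> may be 0; \<open>B + 1\<close> can be inverted.\<close>
  have "inverse (B + 1) * norm v \<le> norm (f v - scaleC z v)" for v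
  proof -
    have "norm v \<le> B * norm (f v - scaleC z v)"
      using B(2)[of "scaleC z v - f v"] by (simp add: g(2) norm_minus_commute)
    also have "\<dots> \<le> (B + 1) * norm (f v - scaleC z v)" by (simp add: mult_right_mono)
    finally show ?thesis using B(1) by (simp add: field_simps)
  qed
  then show ?thesis using B(1) by (intro exI[of _ "inverse (B + 1)"]) simp
qed

text \<open>If \<open>\<lambda> = \<parallel>q(f)\<parallel>\<close> exceeded \<open>|q|\<close> on the spectrum, all factors of \<open>q\<^sup>2 - \<lambda>\<^sup>2\<close> at \<open>f\<close> would be
  bounded below, whereas \<open>\<lambda>\<^sup>2\<close> is an approximate eigenvalue of \<open>q(f)\<^sup>2\<close>.\<close>

lemma norm_op_poly_le_nonconstant:
  assumes f: "bounded_clinear f" and sa: "op_selfadjoint f" and M: "0 \<le> M"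
    and q: "\<And>s. complex_of_real s \<in> op_spectrum f \<Longrightarrow> \<bar>poly q s\<bar> \<le> M"
    and deg: "degree q > 0"
  shows "norm (op_poly q f v) \<le> M * norm v"
proof -
  define g where "g = op_poly q f"
  have g: "bounded_clinear g" "op_selfadjoint g"
    unfolding g_def using bounded_clinear_op_poly[OF f] op_selfadjoint_op_poly[OF sa] by auto
  define l where "l = onorm g"
  have gl: "norm (g u) \<le> l * norm u" for u
    unfolding l_def by (rule onorm[OF bounded_clinear_linear[OF g(1)]])
  have "l \<le> M"
  proof (rule ccontr)
    assume "\<not> l \<le> M"
    then have l: "M < l" "0 < l" using M by auto
    define r where "r = q * q - [:l\<^sup>2:]"
    \<comment> \<open>This is where \<open>deg\<close> enters: for a constant \<open>q\<close> of
      absolute value \<open>l\<close> the polynomial \<open>r\<close> would be zero.\<close>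
    have "r \<noteq> 0"
    proof
      assume "r = 0"
      then have "degree (q * q) = 0" by (simp add: r_def)
      moreover have "q \<noteq> 0" using deg by auto
      ultimately show False using deg by (simp add: degree_mult_eq)
    qed
    have "\<exists>c>0. \<forall>u. c * norm u \<le> norm (f u - scaleC \<mu> u)" if "poly (map_poly complex_of_real r) \<mu> = 0" for \<mu>
    proof (cases "Im \<mu> = 0")
      case True
      then have \<mu>: "\<mu> = complex_of_real (Re \<mu>)" by (simp add: complex_eq_iff)
      from that have "poly r (Re \<mu>) = 0"
        by (subst (asm) \<mu>) (simp only: of_real_hom.poly_map_poly of_real_eq_0_iff)
      then have "\<bar>poly q (Re \<mu>)\<bar> = l"
        using l(2) by (simp add: r_def power2_eq_square[symmetric] flip: abs_square_eq_1)
          (metis abs_of_pos power2_eq_iff abs_minus_cancel)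
      then have "\<mu> \<notin> op_spectrum f" using q[of "Re \<mu>"] \<mu> l by auto
      then show ?thesis by (rule bounded_below_not_in_op_spectrum)
    next
      case False
      then show ?thesis using op_selfadjoint_bounded_below[OF sa] by (intro exI[of _ "\<bar>Im \<mu>\<bar>"]) auto
    qed
    moreover have "map_poly complex_of_real r \<noteq> 0"
      using \<open>r \<noteq> 0\<close> by (simp add: map_poly_eq_0_iff)
    ultimately have "\<exists>c>0. \<forall>u. c * norm u \<le> norm (op_cpoly (map_poly complex_of_real r) f u)"
      by (intro op_cpoly_bounded_below[OF f])
    then obtain c where c: "c > 0" "\<And>u. c * norm u \<le> norm (op_poly r f u)"
      by (auto simp: op_poly_eq_op_cpoly)
    have rf: "op_poly r f u = g (g u) - l\<^sup>2 *\<^sub>R u" for u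
      by (simp add: r_def op_poly_diff[OF f] op_poly_mult[OF f] g_def)
    \<comment> \<open>Expanding the squared norm of \<open>g (g u) - l^2 u\<close> bounds it above
      by \<open>l^4 (norm u)^2 - l^2 (norm (g u))^2\<close>, while \<open>c\<close> bounds it below.
      Solving for \<open>norm (g u)\<close> gives this constant, which is strictly smaller than the
      operator norm \<open>l\<close>.\<close>
    have "norm (g u) \<le> sqrt (l\<^sup>2 - c\<^sup>2 / l\<^sup>2) * norm u" for u
    proof -
      have "Re (cinner (g (g u)) (l\<^sup>2 *\<^sub>R u)) = l\<^sup>2 * (norm (g u))\<^sup>2"
        using g(2) by (simp add: cinner_scaleR_right op_selfadjoint_def cinner_self del: of_real_power)
      then have "(norm (op_poly r f u))\<^sup>2 = (norm (g (g u)))\<^sup>2 - 2 * l\<^sup>2 * (norm (g u))\<^sup>2 + l ^ 4 * (norm u)\<^sup>2"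
        unfolding rf norm_diff_sq by (simp add: power_mult_distrib)
      also have "(norm (g (g u)))\<^sup>2 \<le> (l * norm (g u))\<^sup>2"
        by (rule power_mono[OF gl]) simp
      finally have "(norm (op_poly r f u))\<^sup>2 \<le> l ^ 4 * (norm u)\<^sup>2 - l\<^sup>2 * (norm (g u))\<^sup>2"
        by (simp add: power_mult_distrib)
      moreover have "(c * norm u)\<^sup>2 \<le> (norm (op_poly r f u))\<^sup>2"
        using c by (intro power_mono) auto
      ultimately have "l\<^sup>2 * (norm (g u))\<^sup>2 \<le> l ^ 4 * (norm u)\<^sup>2 - c\<^sup>2 * (norm u)\<^sup>2"
        by (simp add: power_mult_distrib)
      then have "(norm (g u))\<^sup>2 \<le> (l\<^sup>2 - c\<^sup>2 / l\<^sup>2) * (norm u)\<^sup>2"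
        using l by (simp add: field_simps power2_eq_square power4_eq_xxxx)
      then have "sqrt ((norm (g u))\<^sup>2) \<le> sqrt ((l\<^sup>2 - c\<^sup>2 / l\<^sup>2) * (norm u)\<^sup>2)"
        by (rule real_sqrt_le_mono)
      then show ?thesis by (simp add: real_sqrt_mult)
    qed
    \<comment> \<open>\<open>sqrt\<close> is negative on negative numbers in HOL; a negative
      radicand would force \<open>g\<close> to vanish, against \<open>0 < l\<close>.\<close>
    moreover have "0 \<le> sqrt (l\<^sup>2 - c\<^sup>2 / l\<^sup>2)"
    proof (rule ccontr)
      assume neg: "\<not> 0 \<le> sqrt (l\<^sup>2 - c\<^sup>2 / l\<^sup>2)"
      have "norm (g u) \<le> 0 * norm u" for u
        by (rule order_trans[OF calculation mult_right_mono]) (use neg in auto)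
      then have "l \<le> 0" unfolding l_def by (intro onorm_bound) auto
      then show False using l by simp
    qed
    ultimately have "l \<le> sqrt (l\<^sup>2 - c\<^sup>2 / l\<^sup>2)"
      unfolding l_def[symmetric] by (subst l_def) (rule onorm_bound)
    also have "\<dots> < sqrt (l\<^sup>2)" using c l by (intro real_sqrt_less_mono) simp
    finally show False using l by simp
  qed
  then show ?thesis using gl[of v] unfolding g_def[symmetric]
    by (meson mult_right_mono norm_ge_zero order_trans)
qed

text \<open>For a constant polynomial the claim amounts to the spectrum having a real point when the
  space is nonzero. Otherwise the nonconstant case for the polynomial \<open>[:0, 1:]\<close> with
  bound 0 gives \<open>f = 0\<close>, whose spectrum contains 0.\<close>

lemma norm_op_poly_le:
  assumes f: "bounded_clinear f" and sa: "op_selfadjoint f" and M: "0 \<le> M"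
    and q: "\<And>s. complex_of_real s \<in> op_spectrum f \<Longrightarrow> \<bar>poly q s\<bar> \<le> M"
  shows "norm (op_poly q f v) \<le> M * norm v"
proof (cases "degree q = 0 \<and> v \<noteq> 0")
  case True
  then obtain a where a: "q = [:a:]" by (metis degree_eq_zeroE)
  have "\<bar>a\<bar> \<le> M"
  proof (rule ccontr)
    assume "\<not> \<bar>a\<bar> \<le> M"
    then have no: "complex_of_real s \<notin> op_spectrum f" for s using q[of s] a by auto
    have "norm (op_poly [:0, 1:] f u) \<le> 0 * norm u" for u
      by (rule norm_op_poly_le_nonconstant[OF f sa]) (use no in auto)
    then have "f u = 0" for u by (simp add: op_poly_def)
    then obtain g where "bounded_clinear g" "\<And>u. g 0 = (u :: 'a)"
      using no[of 0] by (auto simp: op_spectrum_def)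
    then show False using True bounded_clinear_zero by metis
  qed
  then show ?thesis by (simp add: a mult_right_mono)
next
  case False
  then show ?thesis
    using norm_op_poly_le_nonconstant[OF assms] bounded_clinear_zero[OF bounded_clinear_op_poly[OF f]]
    by (cases "v = 0") auto
qed

section \<open>The spectrum of a nonnegative operator\<close>

text \<open>Instead of summing the Neumann series, \<open>g w\<close> is taken to be the unique
  fixed point of the contraction \<open>v \<mapsto> w + B v\<close>; uniqueness of the fixed point
  yields linearity and the left inverse.\<close>

lemma Neumann_inverse:
  assumes B: "bounded_clinear B" and le: "\<And>v. norm (B v) \<le> \<beta> * norm v" and "0 \<le> \<beta>" "\<beta> < 1"
  obtains g where "bounded_clinear g" "\<And>v. g (v - B v) = v" "\<And>v. g v - B (g v) = v"
proof -
  have "\<exists>!v. w + B v = v" for w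
  proof (rule banach_fix_type[OF \<open>0 \<le> \<beta>\<close> \<open>\<beta> < 1\<close>], intro allI)
    show "dist (w + B x) (w + B y) \<le> \<beta> * dist x y" for x y
      using le[of "x - y"] by (simp add: dist_norm bounded_clinear_diff[OF B])
  qed
  then obtain g where g: "\<And>w. w + B (g w) = g w" and uniq: "\<And>w v. w + B v = v \<Longrightarrow> v = g w" by metis
  have "bounded_clinear g"
  proof (rule bounded_clinearI)
    show "g (v + w) = g v + g w" for v w
      by (rule uniq[symmetric]) (metis (no_types) B add.assoc add.left_commute bounded_clinear_add g)
    show "g (scaleC c v) = scaleC c (g v)" for c v
      by (rule uniq[symmetric]) (metis (no_types) B bounded_clinear_scaleC g scaleC_add_right)
    show "norm (g v) \<le> inverse (1 - \<beta>) * norm v" for v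
    proof -
      have "norm (g v) \<le> norm v + \<beta> * norm (g v)"
        using norm_triangle_ineq[of v "B (g v)"] le[of "g v"] by (simp add: g)
      then show ?thesis using \<open>\<beta> < 1\<close> by (simp add: field_simps)
    qed
  qed
  moreover have "g (v - B v) = v" for v by (rule uniq[symmetric]) simp
  moreover have "g v - B (g v) = v" for v using g[of v] by (simp add: algebra_simps)
  ultimately show ?thesis using that by blast
qed

lemma not_in_op_spectrumI:
  assumes f: "bounded_clinear f" and c: "c \<noteq> 0" and B: "bounded_clinear B"
    and le: "\<And>v. norm (B v) \<le> \<beta> * norm v" and "0 \<le> \<beta>" "\<beta> < 1"
    and eq: "\<And>v. scaleC z v - f v = scaleC c (v - B v)"
  shows "z \<notin> op_spectrum f"
proof -
  obtain g where g: "bounded_clinear g" "\<And>v. g (v - B v) = v" "\<And>v. g v - B (g v) = v"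
    using Neumann_inverse[OF B le \<open>0 \<le> \<beta>\<close> \<open>\<beta> < 1\<close>] by metis
  have "bounded_clinear (\<lambda>v. scaleC (inverse c) (g v))"
    by (rule bounded_clinear_const_scaleC[OF g(1)])
  moreover have "scaleC (inverse c) (g (scaleC z v - f v)) = v" for v
    unfolding eq using c by (simp add: bounded_clinear_scaleC[OF g(1)] g scaleC_scaleC)
  moreover have "scaleC z (scaleC (inverse c) (g v)) - f (scaleC (inverse c) (g v)) = v" for v
    unfolding eq using c
    by (simp add: bounded_clinear_scaleC[OF B] g scaleC_scaleC scaleC_diff_right[symmetric])
  ultimately show ?thesis unfolding op_spectrum_def by blast
qed

text \<open>Outside \<open>{0..R}\<close> the operator \<open>s - f\<close> is a nonzero scalar
  times a perturbation of the identity by a contraction. For \<open>s > R\<close> this is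
  \<open>s (1 - f / s)\<close>. For \<open>s < 0\<close> it is
  \<open>(s - R) (1 - (R - f) / (R - s))\<close>, where positivity makes the norm of
  \<open>R - f\<close> at most \<open>R\<close>.\<close>

lemma op_spectrum_nonneg:
  assumes f: "bounded_clinear f" and pos: "op_nonneg f" and R: "\<And>v. norm (f v) \<le> R * norm v" "0 \<le> R"
    and s: "complex_of_real s \<in> op_spectrum f"
  shows "0 \<le> s \<and> s \<le> R"
proof (rule ccontr)
  assume "\<not> (0 \<le> s \<and> s \<le> R)"
  then consider "s < 0" | "s > R" by linarith
  then show False
  proof cases
    case 1
    have le: "norm (R *\<^sub>R v - f v) \<le> R * norm v" for v
    proof -
      \<comment> \<open>Cauchy-Schwarz for the form of \<open>f\<close> at \<open>v\<close> and
        \<open>f v\<close>. It lets the cross term in the expansion of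
        \<open>norm (R v - f v)\<close> absorb the square of \<open>norm (f v)\<close>.\<close>
      have fv: "(norm (f v))\<^sup>2 \<le> R * Re (cinner (f v) v)"
      proof (cases "f v = 0")
        case False
        have "((norm (f v))\<^sup>2)\<^sup>2 \<le> Re (cinner (f v) v) * Re (cinner (f (f v)) (f v))"
          using op_nonneg_Cauchy_Schwarz[OF f pos, of v "f v"] by (simp add: cinner_self norm_power)
        also have "\<dots> \<le> Re (cinner (f v) v) * (R * (norm (f v))\<^sup>2)"
        proof (rule mult_left_mono)
          have "Re (cinner (f (f v)) (f v)) \<le> norm (f (f v)) * norm (f v)"
            by (rule order_trans[OF complex_Re_le_cmod cinner_Cauchy_Schwarz])
          also have "\<dots> \<le> R * norm (f v) * norm (f v)" by (intro mult_right_mono R) simp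
          finally show "Re (cinner (f (f v)) (f v)) \<le> R * (norm (f v))\<^sup>2"
            by (simp add: power2_eq_square mult.assoc)
        qed (use pos in \<open>simp add: op_nonneg_def\<close>)
        finally have "(norm (f v))\<^sup>2 * (norm (f v))\<^sup>2 \<le> (R * Re (cinner (f v) v)) * (norm (f v))\<^sup>2"
          by (simp add: power2_eq_square mult_ac)
        then show ?thesis by (rule mult_right_le_imp_le) (use False in simp)
      qed (use pos R(2) in \<open>simp add: op_nonneg_def\<close>)
      have "0 \<le> R * Re (cinner (f v) v)" using pos R(2) by (simp add: op_nonneg_def)
      then have "(norm (R *\<^sub>R v - f v))\<^sup>2 \<le> (R * norm v)\<^sup>2"
        using fv by (simp add: norm_diff_sq cinner_scaleR_left cinner_commute[of v "f v"] power_mult_distrib)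
      then show ?thesis by (rule power2_le_imp_le) (use R(2) in simp)
    qed
    have "complex_of_real s \<notin> op_spectrum f"
    proof (rule not_in_op_spectrumI[OF f, of "complex_of_real (s - R)" "\<lambda>v. inverse (R - s) *\<^sub>R (R *\<^sub>R v - f v)" "R / (R - s)"])
      show "bounded_clinear (\<lambda>v. inverse (R - s) *\<^sub>R (R *\<^sub>R v - f v))"
        by (intro bounded_clinear_const_scaleR bounded_clinear_minus bounded_clinear_id f)
      show "norm (inverse (R - s) *\<^sub>R (R *\<^sub>R v - f v)) \<le> R / (R - s) * norm v" for v
        using le[of v] 1 R(2) by (simp add: divide_simps)
      show "scaleC (complex_of_real s) v - f v
          = scaleC (complex_of_real (s - R)) (v - inverse (R - s) *\<^sub>R (R *\<^sub>R v - f v))" for v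
      proof -
        have "(s - R) * inverse (R - s) = - 1" using 1 R(2) by (simp add: divide_simps)
        then have "(s - R) *\<^sub>R (inverse (R - s) *\<^sub>R (R *\<^sub>R v - f v)) = - (R *\<^sub>R v - f v)"
          by (simp only: scaleR_scaleR) simp
        then show ?thesis unfolding scaleC_of_real scaleR_diff_right[of "s - R"]
          by (simp add: algebra_simps)
      qed
    qed (use 1 R(2) in auto)
    then show False using s by simp
  next
    case 2
    have "complex_of_real s \<notin> op_spectrum f"
    proof (rule not_in_op_spectrumI[OF f, of "complex_of_real s" "\<lambda>v. inverse s *\<^sub>R f v" "R / s"])
      show "norm (inverse s *\<^sub>R f v) \<le> R / s * norm v" for v
        using R(1)[of v] R(2) 2 by (simp add: divide_simps)
    qed (use 2 R(2) f in \<open>auto simp: bounded_clinear_const_scaleR scaleC_of_real scaleR_diff_right\<close>)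
    then show False using s by simp
  qed
qed

section \<open>Continuous functional calculus\<close>

lemma polynomials_uniform_limit:
  fixes h :: "real \<Rightarrow> real"
  assumes "continuous_on {a..b} h"
  obtains q :: "nat \<Rightarrow> real poly" where "uniform_limit {a..b} (\<lambda>l. poly (q l)) h sequentially"
proof -
  have "\<exists>q::real poly. \<forall>s\<in>{a..b}. \<bar>poly q s - h s\<bar> < inverse (real (Suc l))" for l
  proof -
    obtain g where g: "real_polynomial_function g" "\<And>x. x \<in> {a..b} \<Longrightarrow> \<bar>h x - g x\<bar> < inverse (real (Suc l))"
      using Stone_Weierstrass_real_polynomial_function[OF compact_Icc assms, of "inverse (real (Suc l))"] by auto
    obtain c n where "g = (\<lambda>x. \<Sum>i\<le>n. c i * x ^ i)"
      using g(1) unfolding real_polynomial_function_iff_sum by blast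
    then have "g x = poly (\<Sum>i\<le>n. monom (c i) i) x" for x by (simp add: poly_sum poly_monom)
    then show ?thesis using g(2) by (intro exI[of _ "\<Sum>i\<le>n. monom (c i) i"]) (auto simp: abs_minus_commute)
  qed
  then obtain q :: "nat \<Rightarrow> real poly" where
    q: "\<And>l s. s \<in> {a..b} \<Longrightarrow> \<bar>poly (q l) s - h s\<bar> < inverse (real (Suc l))" by metis
  have "uniform_limit {a..b} (\<lambda>l. poly (q l)) h sequentially"
  proof (rule uniform_limitI)
    fix e :: real assume "0 < e"
    then have "eventually (\<lambda>l. inverse (real (Suc l)) < e) sequentially"
      using order_tendstoD(2)[OF LIMSEQ_inverse_real_of_nat] by blast
    then show "\<forall>\<^sub>F l in sequentially. \<forall>s\<in>{a..b}. dist (poly (q l) s) (h s) < e"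
      by eventually_elim (auto simp: dist_real_def intro: less_trans[OF q])
  qed
  then show ?thesis using that by blast
qed

text \<open>\<open>norm_op_poly_le\<close> makes \<open>op_poly (Q l) f\<close> Cauchy at every
  vector, and the limit is what the definite description denotes. The error is measured on
  \<open>{0..R}\<close> and not on the spectrum: a single polynomial then serves \<open>f\<close>
  and all its compressions, whose spectra vary with the frame.\<close>

lemma op_cfc_characterisation:
  assumes f: "bounded_clinear f" and pos: "op_nonneg f" and R: "\<And>v. norm (f v) \<le> R * norm v" "0 \<le> R"
    and h: "continuous_on {0..R} h"
  shows bounded_clinear_op_cfc: "bounded_clinear (op_cfc h f)"
    and op_selfadjoint_op_cfc: "op_selfadjoint (op_cfc h f)"
    and op_cfc_approx: "(\<And>s. s \<in> {0..R} \<Longrightarrow> \<bar>poly q s - h s\<bar> \<le> e)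
      \<Longrightarrow> norm (op_poly q f v - op_cfc h f v) \<le> e * norm v"
proof -
  have sa: "op_selfadjoint f" using pos by (simp add: op_nonneg_def)
  have spec: "{s. complex_of_real s \<in> op_spectrum f} \<subseteq> {0..R}"
    using op_spectrum_nonneg[OF f pos R] by auto
  have R0: "(0::real) \<in> {0..R}" using R(2) by auto
  obtain Q where Q: "uniform_limit {0..R} (\<lambda>l. poly (Q l)) h sequentially"
    using polynomials_uniform_limit[OF h] by blast
  have diff_bound: "norm (op_poly p f u - op_poly q f u) \<le> (d + e) * norm u"
    if "\<And>s. s \<in> {0..R} \<Longrightarrow> \<bar>poly p s - h s\<bar> \<le> d" "\<And>s. s \<in> {0..R} \<Longrightarrow> \<bar>poly q s - h s\<bar> \<le> e" for p q d e u
  proof -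
    have le: "\<bar>poly (p - q) s\<bar> \<le> d + e" if "s \<in> {0..R}" for s
      using \<open>\<And>s. s \<in> {0..R} \<Longrightarrow> \<bar>poly p s - h s\<bar> \<le> d\<close>[OF that]
        \<open>\<And>s. s \<in> {0..R} \<Longrightarrow> \<bar>poly q s - h s\<bar> \<le> e\<close>[OF that] by simp
    have "norm (op_poly (p - q) f u) \<le> (d + e) * norm u"
      by (rule norm_op_poly_le[OF f sa]) (use le spec order_trans[OF abs_ge_zero le[OF R0]] in auto)
    then show ?thesis by (simp add: op_poly_diff[OF f])
  qed
  have Qe: "\<forall>\<^sub>F l in sequentially. \<forall>s\<in>{0..R}. \<bar>poly (Q l) s - h s\<bar> \<le> d" if "d > 0" for d
    using uniform_limitD[OF Q that] by eventually_elim (force simp: dist_real_def)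
  have "Cauchy (\<lambda>l. op_poly (Q l) f u)" for u
  proof (rule metric_CauchyI)
    fix e :: real assume e: "0 < e"
    \<comment> \<open>Chosen so that \<open>(d + d) * norm u < e\<close>; the added 1 covers
      \<open>u = 0\<close>.\<close>
    define d where "d = e / (4 * (norm u + 1))"
    have "0 < norm u + 1" by (simp add: add_nonneg_pos)
    then have d: "d > 0" "(d + d) * norm u < e"
      using e by (simp_all add: d_def field_simps add_pos_nonneg)
    obtain L where L: "\<And>l s. l \<ge> L \<Longrightarrow> s\<in>{0..R} \<Longrightarrow> \<bar>poly (Q l) s - h s\<bar> \<le> d"
      using Qe[OF d(1)] unfolding eventually_sequentially by blast
    show "\<exists>M. \<forall>m\<ge>M. \<forall>n\<ge>M. dist (op_poly (Q m) f u) (op_poly (Q n) f u) < e"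
      using diff_bound[OF L L] d(2) unfolding dist_norm by (meson le_less_trans)
  qed
  then have "convergent (\<lambda>l. op_poly (Q l) f u)" for u
    by (rule Cauchy_convergent)
  then have g: "(\<lambda>l. op_poly (Q l) f u) \<longlonglongrightarrow> lim (\<lambda>l. op_poly (Q l) f u)" for u
    by (simp add: convergent_LIMSEQ_iff)
  define g where "g u = lim (\<lambda>l. op_poly (Q l) f u)" for u
  note g = g[folded g_def]
  have g_approx: "norm (op_poly q f u - g u) \<le> e * norm u"
    if q: "\<And>s. s \<in> {0..R} \<Longrightarrow> \<bar>poly q s - h s\<bar> \<le> e" for q e u
  proof (rule field_le_epsilon)
    fix \<epsilon> :: real assume "0 < \<epsilon>"
    define d where "d = \<epsilon> / (norm u + 1)"
    have "0 < norm u + 1" by (simp add: add_nonneg_pos)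
    then have d: "d > 0" "d * norm u \<le> \<epsilon>"
      using \<open>0 < \<epsilon>\<close> by (simp_all add: d_def field_simps)
    have "\<forall>\<^sub>F l in sequentially. norm (op_poly q f u - op_poly (Q l) f u) \<le> e * norm u + \<epsilon>"
      using Qe[OF d(1)]
    proof eventually_elim
      case (elim l)
      have "norm (op_poly q f u - op_poly (Q l) f u) \<le> (e + d) * norm u"
        by (rule diff_bound) (use q elim in auto)
      then show ?case using d(2) by (simp add: distrib_right)
    qed
    moreover have "(\<lambda>l. norm (op_poly q f u - op_poly (Q l) f u)) \<longlonglongrightarrow> norm (op_poly q f u - g u)"
      by (intro tendsto_intros g)
    ultimately show "norm (op_poly q f u - g u) \<le> e * norm u + \<epsilon>"
      by (intro tendsto_upperbound) auto
  qed
  \<comment> \<open>One approximant within 1 of \<open>h\<close> transfers its norm bound to the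
    limit \<open>g\<close>.\<close>
  obtain l0 where l0: "\<And>s. s \<in> {0..R} \<Longrightarrow> \<bar>poly (Q l0) s - h s\<bar> \<le> 1"
    using eventually_happens[OF Qe[of 1]] by fastforce
  obtain B where B: "\<And>u. norm (op_poly (Q l0) f u) \<le> B * norm u"
    using bounded_clinear_bound[OF bounded_clinear_op_poly[OF f, of "Q l0"]] by blast
  have gb: "bounded_clinear g"
  proof (rule bounded_clinearI)
    show "g (u + w) = g u + g w" for u w
      by (rule LIMSEQ_unique[OF g])
        (use tendsto_add[OF g[of u] g[of w]] in \<open>simp add: bounded_clinear_add[OF bounded_clinear_op_poly[OF f]]\<close>)
    show "g (scaleC c u) = scaleC c (g u)" for c u
      by (rule LIMSEQ_unique[OF g])
        (use tendsto_scaleC[OF g[of u], of c] in \<open>simp add: bounded_clinear_scaleC[OF bounded_clinear_op_poly[OF f]]\<close>)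
    show "norm (g u) \<le> (B + 1) * norm u" for u
    proof -
      have "norm (op_poly (Q l0) f u - g u) \<le> 1 * norm u" by (rule g_approx) (rule l0)
      then show ?thesis
        using B[of u] norm_triangle_ineq4[of "op_poly (Q l0) f u" "op_poly (Q l0) f u - g u"]
        by (simp add: distrib_right)
    qed
  qed
  have conv: "(\<lambda>l. onorm (\<lambda>v. op_poly (Q l) f v - g v)) \<longlonglongrightarrow> 0"
  proof (rule tendstoI)
    fix e :: real assume "0 < e"
    have "\<forall>\<^sub>F l in sequentially. \<forall>s\<in>{0..R}. \<bar>poly (Q l) s - h s\<bar> \<le> e / 2"
      by (rule Qe) (use \<open>0 < e\<close> in simp)
    then show "\<forall>\<^sub>F l in sequentially. dist (onorm (\<lambda>v. op_poly (Q l) f v - g v)) 0 < e"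
    proof eventually_elim
      case (elim l)
      have "onorm (\<lambda>v. op_poly (Q l) f v - g v) \<le> e / 2"
        by (rule onorm_bound, use \<open>0 < e\<close> in simp, rule g_approx) (use elim in auto)
      moreover have "0 \<le> onorm (\<lambda>v. op_poly (Q l) f v - g v)"
        by (intro onorm_pos_le bounded_clinear_linear bounded_clinear_minus bounded_clinear_op_poly f gb)
      ultimately show ?case using \<open>0 < e\<close> by simp
    qed
  qed
  have cfc: "op_cfc h f = g"
    unfolding op_cfc_def
  proof (rule the_equality)
    show "bounded_clinear g \<and> (\<exists>q :: nat \<Rightarrow> real poly.
       uniform_limit {s. complex_of_real s \<in> op_spectrum f} (\<lambda>l. poly (q l)) h sequentially \<and>
       (\<lambda>l. onorm (\<lambda>v. op_poly (q l) f v - g v)) \<longlonglongrightarrow> 0)"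
      using gb conv uniform_limit_on_subset[OF Q spec] by blast
    fix g' assume "bounded_clinear g' \<and> (\<exists>q :: nat \<Rightarrow> real poly.
       uniform_limit {s. complex_of_real s \<in> op_spectrum f} (\<lambda>l. poly (q l)) h sequentially \<and>
       (\<lambda>l. onorm (\<lambda>v. op_poly (q l) f v - g' v)) \<longlonglongrightarrow> 0)"
    then obtain q :: "nat \<Rightarrow> real poly" where g': "bounded_clinear g'"
      and q: "uniform_limit {s. complex_of_real s \<in> op_spectrum f} (\<lambda>l. poly (q l)) h sequentially"
      and lim: "(\<lambda>l. onorm (\<lambda>v. op_poly (q l) f v - g' v)) \<longlonglongrightarrow> 0" by blast
    have "g' u = g u" for u
    proof -
      have "(\<lambda>l. op_poly (q l) f u - g' u) \<longlonglongrightarrow> 0"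
      proof (rule Lim_null_comparison)
        show "\<forall>\<^sub>F l in sequentially. norm (op_poly (q l) f u - g' u)
            \<le> onorm (\<lambda>v. op_poly (q l) f v - g' v) * norm u"
          by (intro always_eventually allI onorm bounded_clinear_linear bounded_clinear_minus
              bounded_clinear_op_poly f g')
        show "(\<lambda>l. onorm (\<lambda>v. op_poly (q l) f v - g' v) * norm u) \<longlonglongrightarrow> 0"
          using tendsto_mult_right[OF lim, of "norm u"] by simp
      qed
      \<comment> \<open>A rival sequence \<open>q\<close> is known to approach \<open>h\<close> only
        on the spectrum, so it is compared with \<open>Q\<close> there; this is all that
        \<open>norm_op_poly_le\<close> asks for.\<close>
      moreover have "(\<lambda>l. op_poly (Q l) f u - op_poly (q l) f u) \<longlonglongrightarrow> 0"
      proof (rule tendstoI)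
        fix e :: real assume "0 < e"
        define d where "d = e / (4 * (norm u + 1))"
        have "0 < norm u + 1" by (simp add: add_nonneg_pos)
        then have d: "d > 0" "(d + d) * norm u < e"
          using \<open>0 < e\<close> by (simp_all add: d_def field_simps add_pos_nonneg)
        have "\<forall>\<^sub>F l in sequentially. \<forall>s\<in>{s. complex_of_real s \<in> op_spectrum f}. \<bar>poly (Q l - q l) s\<bar> \<le> d + d"
          using Qe[OF d(1)] uniform_limitD[OF q d(1)]
        proof eventually_elim
          case (elim l)
          show ?case
          proof
            fix s assume "s \<in> {s. complex_of_real s \<in> op_spectrum f}"
            then have "\<bar>poly (Q l) s - h s\<bar> \<le> d" "dist (poly (q l) s) (h s) < d" using elim spec by auto
            then show "\<bar>poly (Q l - q l) s\<bar> \<le> d + d" by (simp add: dist_real_def)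
          qed
        qed
        then show "\<forall>\<^sub>F l in sequentially. dist (op_poly (Q l) f u - op_poly (q l) f u) 0 < e"
        proof eventually_elim
          case (elim l)
          have "norm (op_poly (Q l - q l) f u) \<le> (d + d) * norm u"
            by (rule norm_op_poly_le[OF f sa]) (use elim d in auto)
          then show ?case using d(2) by (simp add: op_poly_diff[OF f])
        qed
      qed
      ultimately have "(\<lambda>l. op_poly (Q l) f u - g' u) \<longlonglongrightarrow> 0 + 0"
        using tendsto_add by fastforce
      then have "(\<lambda>l. op_poly (Q l) f u) \<longlonglongrightarrow> g' u" by (simp add: LIM_zero_iff)
      then show ?thesis using g LIMSEQ_unique by blast
    qed
    then show "g' = g" by blast
  qed
  show "bounded_clinear (op_cfc h f)" using gb cfc by simp
  show "op_selfadjoint (op_cfc h f)"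
    unfolding cfc op_selfadjoint_def
  proof (intro allI)
    fix u w
    have "(\<lambda>l. cinner (op_poly (Q l) f u) w) \<longlonglongrightarrow> cinner (g u) w"
      by (intro tendsto_cinner g tendsto_const)
    moreover have "(\<lambda>l. cinner (op_poly (Q l) f u) w) \<longlonglongrightarrow> cinner u (g w)"
      using op_selfadjoint_op_poly[OF sa] tendsto_cinner[OF tendsto_const g, of u w]
      by (simp add: op_selfadjoint_def)
    ultimately show "cinner (g u) w = cinner u (g w)" by (rule LIMSEQ_unique)
  qed
  show "norm (op_poly q f v - op_cfc h f v) \<le> e * norm v"
    if "\<And>s. s \<in> {0..R} \<Longrightarrow> \<bar>poly q s - h s\<bar> \<le> e"
    unfolding cfc by (rule g_approx) (rule that)
qed

section \<open>Matrices as finite-rank operators\<close>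

lemma mat_mult_index:
  assumes "A \<in> carrier_mat k k" "B \<in> carrier_mat k k" "a < k" "b < k"
  shows "(A * B) $$ (a, b) = (\<Sum>c<k. A $$ (a, c) * B $$ (c, b))"
  using assms by (simp add: scalar_prod_def atLeast0LessThan)

lemma mat_adjoint_index:
  assumes "A \<in> carrier_mat k k" "a < k" "b < k"
  shows "mat_adjoint A $$ (a, b) = cnj (A $$ (b, a))"
  using assms by (simp add: mat_adjoint_def mat_of_rows_def)

lemma mat_adjoint_carrier:
  "A \<in> carrier_mat k k \<Longrightarrow> mat_adjoint A \<in> carrier_mat k k"
  by (auto simp: mat_adjoint_def)

lemma mat_quadratic_form:
  fixes A :: "complex mat"
  assumes "A \<in> carrier_mat k k" "v \<in> carrier_vec k"
  shows "(A *\<^sub>v v) \<bullet>c v = (\<Sum>a<k. \<Sum>b<k. A $$ (a, b) * vec_index v b * cnj (vec_index v a))"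
  using assms by (simp add: scalar_prod_def atLeast0LessThan sum_distrib_right)

lemma bounded_clinear_rank_one:
  "bounded_clinear (\<lambda>w. scaleC (c * cinner w u) (v :: 'h::complex_hilbert_space))"
proof (rule bounded_clinearI)
  show "norm (scaleC (c * cinner w u) v) \<le> cmod c * norm u * norm v * norm w" for w
    using mult_left_mono[OF cinner_Cauchy_Schwarz[of w u], of "cmod c * norm v"]
    by (simp add: norm_scaleC norm_mult mult_ac)
qed (simp_all add: cinner_add_left cinner_scaleC_left distrib_left scaleC_add_left scaleC_scaleC mult_ac)

text \<open>Only the values of \<open>e\<close> below \<open>k\<close> count, so Gram-Schmidt can
  extend a frame by updating \<open>e\<close> at \<open>k\<close>; its start is the empty frame
  \<open>k = 0\<close>.\<close>

locale orthonormal_frame =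
  fixes e :: "nat \<Rightarrow> 'h::complex_hilbert_space" and k :: nat
  assumes ortho: "\<lbrakk>a < k; b < k\<rbrakk> \<Longrightarrow> cinner (e a) (e b) = (if a = b then 1 else 0)"
begin

definition proj :: "'h \<Rightarrow> 'h" where
  "proj w = (\<Sum>a<k. scaleC (cinner w (e a)) (e a))"

text \<open>The functional calculus and the norm bound concern operators on a whole type
  \<open>'h\<close>, so a matrix is made into one by extending it by zero on the orthogonal
  complement of the frame.\<close>

definition mop :: "complex mat \<Rightarrow> 'h \<Rightarrow> 'h" where
  "mop A w = (\<Sum>a<k. \<Sum>b<k. scaleC (A $$ (a, b) * cinner w (e b)) (e a))"

text \<open>The matrix of \<open>proj \<circ> f \<circ> proj\<close>. The row index stands in the
  second argument of \<open>cinner\<close>, the conjugate-linear one.\<close>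

definition compress :: "('h \<Rightarrow> 'h) \<Rightarrow> complex mat" where
  "compress f = mat k k (\<lambda>(a, b). cinner (f (e b)) (e a))"

definition comb :: "complex Matrix.vec \<Rightarrow> 'h" where
  "comb u = (\<Sum>a<k. scaleC (vec_index u a) (e a))"

definition coord :: "'h \<Rightarrow> complex Matrix.vec" where
  "coord w = Matrix.vec k (\<lambda>a. cinner w (e a))"

lemma compress_carrier [simp]: "compress f \<in> carrier_mat k k"
  by (simp add: compress_def)

lemma bounded_clinear_proj: "bounded_clinear proj"
  unfolding proj_def using bounded_clinear_rank_one[of 1]
  by (intro bounded_clinear_setsum) simp

lemma bounded_clinear_mop: "bounded_clinear (mop A)"
  unfolding mop_def by (intro bounded_clinear_setsum bounded_clinear_rank_one)

lemma cinner_frame_sum: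
  assumes "a < k" shows "cinner (\<Sum>b<k. scaleC (g b) (e b)) (e a) = g a"
proof -
  have "cinner (\<Sum>b<k. scaleC (g b) (e b)) (e a) = (\<Sum>b<k. if b = a then g b else 0)"
    unfolding cinner_sum_left by (rule sum.cong) (auto simp: cinner_scaleC_left ortho assms)
  then show ?thesis using assms by simp
qed

lemma cinner_proj: "a < k \<Longrightarrow> cinner (proj w) (e a) = cinner w (e a)"
  unfolding proj_def by (rule cinner_frame_sum)

lemma mop_alt: "mop A w = (\<Sum>a<k. scaleC (\<Sum>b<k. A $$ (a, b) * cinner w (e b)) (e a))"
  by (simp add: mop_def scaleC_sum_left)

lemma cinner_mop: "a < k \<Longrightarrow> cinner (mop A w) (e a) = (\<Sum>b<k. A $$ (a, b) * cinner w (e b))"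
  unfolding mop_alt by (rule cinner_frame_sum)

lemma proj_frame_sum: "proj (\<Sum>b<k. scaleC (g b) (e b)) = (\<Sum>b<k. scaleC (g b) (e b))"
  unfolding proj_def by (rule sum.cong) (simp_all add: cinner_frame_sum)

lemma proj_proj [simp]: "proj (proj w) = proj w"
  by (subst (2 3) proj_def) (rule proj_frame_sum)

lemma proj_mop [simp]: "proj (mop A w) = mop A w"
  unfolding mop_alt by (rule proj_frame_sum)

lemma proj_comb [simp]: "proj (comb u) = comb u"
  unfolding comb_def by (rule proj_frame_sum)

lemma proj_e: "a < k \<Longrightarrow> proj (e a) = e a"
  using proj_frame_sum[of "\<lambda>b. if b = a then 1 else 0"]
  by (simp add: if_distrib[of "\<lambda>c. scaleC c _"] cong: if_cong)

lemma mop_proj [simp]: "mop A (proj w) = mop A w"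
  unfolding mop_def by (intro sum.cong) (simp_all add: cinner_proj)

lemma mop_entry: "\<lbrakk>a < k; b < k\<rbrakk> \<Longrightarrow> cinner (mop A (e b)) (e a) = A $$ (a, b)"
  by (simp add: cinner_mop ortho if_distrib[of "\<lambda>c. _ * c"] cong: if_cong)

lemma frame_eqI:
  assumes "proj v = v" "proj w = w" "\<And>a. a < k \<Longrightarrow> cinner v (e a) = cinner w (e a)"
  shows "v = w"
proof -
  have "proj v = proj w" unfolding proj_def using assms(3) by (intro sum.cong) simp_all
  then show ?thesis using assms by simp
qed

lemma proj_cinner: "cinner (proj v) w = cinner v (proj w)"
  unfolding proj_def cinner_sum_left cinner_sum_right
  by (rule sum.cong) (simp_all add: cinner_scaleC_left cinner_scaleC_right cinner_commute[of "e _" w] mult.commute)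

lemma norm_proj_le: "norm (proj w) \<le> norm w"
proof (cases "proj w = 0")
  case False
  have "(norm (proj w))\<^sup>2 = cmod (cinner w (proj w))"
    by (metis cinner_self norm_of_real abs_of_nonneg proj_cinner proj_proj zero_le_power2)
  also have "\<dots> \<le> norm w * norm (proj w)" by (rule cinner_Cauchy_Schwarz)
  finally show ?thesis using False by (simp add: power2_eq_square)
qed simp

lemma mop_mult:
  assumes "A \<in> carrier_mat k k" "B \<in> carrier_mat k k"
  shows "mop (A * B) w = mop A (mop B w)"
proof (rule frame_eqI)
  fix a assume a: "a < k"
  have "cinner (mop (A * B) w) (e a) = (\<Sum>b<k. \<Sum>c<k. A $$ (a, c) * B $$ (c, b) * cinner w (e b))"
    unfolding cinner_mop[OF a]
    by (rule sum.cong) (simp_all add: mat_mult_index[OF assms a] sum_distrib_right del: index_mult_mat)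
  also have "\<dots> = (\<Sum>c<k. \<Sum>b<k. A $$ (a, c) * B $$ (c, b) * cinner w (e b))" by (rule sum.swap)
  also have "\<dots> = cinner (mop A (mop B w)) (e a)"
    unfolding cinner_mop[OF a] by (rule sum.cong) (simp_all add: cinner_mop sum_distrib_left mult.assoc)
  finally show "cinner (mop (A * B) w) (e a) = cinner (mop A (mop B w)) (e a)" .
qed simp_all

text \<open>The passage from matrices to operators is multiplicative but sends the unit to a
  projection; hence the \<open>proj w\<close> in the transfer rules for powers, polynomials and
  words.\<close>

lemma mop_one: "mop (1\<^sub>m k) w = proj w"
proof (rule frame_eqI)
  fix a assume a: "a < k"
  have "cinner (mop (1\<^sub>m k) w) (e a) = (\<Sum>b<k. if b = a then cinner w (e b) else 0)"
    unfolding cinner_mop[OF a] by (rule sum.cong) (use a in auto)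
  then show "cinner (mop (1\<^sub>m k) w) (e a) = cinner (proj w) (e a)" using a by (simp add: cinner_proj)
qed simp_all

lemma mop_compress: "mop (compress f) w = proj (f (proj w))" if f: "bounded_clinear f"
proof (rule frame_eqI)
  fix a assume a: "a < k"
  have "cinner (f (proj w)) (e a) = (\<Sum>b<k. cinner w (e b) * cinner (f (e b)) (e a))"
    by (simp add: proj_def bounded_clinear_simps[OF f] cinner_sum_left cinner_scaleC_left)
  then show "cinner (mop (compress f) w) (e a) = cinner (proj (f (proj w))) (e a)"
    using a by (simp add: cinner_mop cinner_proj compress_def mult.commute)
qed simp_all

section \<open>Adjoints and positivity of matrices as operators\<close>

lemma mop_cinner:
  assumes "A \<in> carrier_mat k k"
  shows "cinner (mop A v) w = cinner v (mop (mat_adjoint A) w)"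
proof -
  have "cinner (mop A v) w = (\<Sum>a<k. \<Sum>b<k. A $$ (a, b) * cinner v (e b) * cnj (cinner w (e a)))"
    by (simp add: mop_def cinner_sum_left cinner_scaleC_left cinner_commute[of "e _" w])
  also have "\<dots> = (\<Sum>b<k. \<Sum>a<k. A $$ (a, b) * cinner v (e b) * cnj (cinner w (e a)))"
    by (rule sum.swap)
  also have "\<dots> = cinner v (mop (mat_adjoint A) w)"
    unfolding mop_def cinner_sum_right cinner_scaleC_right
    by (intro sum.cong) (simp_all add: mat_adjoint_index[OF assms] mult_ac)
  finally show ?thesis .
qed

lemma op_adjoint_mop: "A \<in> carrier_mat k k \<Longrightarrow> op_adjoint (mop A) = mop (mat_adjoint A)"
  by (rule op_adjoint_eqI) (rule mop_cinner)

lemma mat_selfadjoint_iff_mop: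
  assumes A: "A \<in> carrier_mat k k"
  shows "mat_selfadjoint A \<longleftrightarrow> op_selfadjoint (mop A)"
proof
  assume "mat_selfadjoint A"
  then show "op_selfadjoint (mop A)"
    using mop_cinner[OF A] by (simp add: op_selfadjoint_def mat_selfadjoint_def)
next
  assume "op_selfadjoint (mop A)"
  then have eq: "mop (mat_adjoint A) = mop A" using op_adjoint_mop[OF A] op_adjoint_selfadjoint by metis
  show "mat_selfadjoint A"
    unfolding mat_selfadjoint_def
  proof (rule eq_matI)
    show "mat_adjoint A $$ (a, b) = A $$ (a, b)" if "a < dim_row A" "b < dim_col A" for a b
      using that A mop_entry[of a b A] mop_entry[of a b "mat_adjoint A"] by (simp add: eq)
  qed (use A mat_adjoint_carrier[OF A] in auto)
qed

lemma coord_comb: "u \<in> carrier_vec k \<Longrightarrow> coord (comb u) = u"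
  by (rule eq_vecI) (simp_all add: coord_def comb_def cinner_frame_sum)

lemma mop_quadratic_form:
  assumes "A \<in> carrier_mat k k"
  shows "cinner (mop A w) w = (A *\<^sub>v coord w) \<bullet>c coord w"
  unfolding mat_quadratic_form[OF assms, of "coord w", unfolded coord_def, simplified] coord_def
  by (simp add: mop_def cinner_sum_left cinner_scaleC_left cinner_commute[of "e _" w]
      mat_quadratic_form[OF assms])

lemma mat_nonneg_iff_mop:
  assumes A: "A \<in> carrier_mat k k"
  shows "mat_nonneg k A \<longleftrightarrow> op_nonneg (mop A)"
  unfolding mat_nonneg_def op_nonneg_def mat_selfadjoint_iff_mop[OF A] mop_quadratic_form[OF A]
proof (intro conj_cong refl iffI ballI allI)
  fix w assume "\<forall>v\<in>carrier_vec k. 0 \<le> Re ((A *\<^sub>v v) \<bullet>c v)"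
  then show "0 \<le> Re ((A *\<^sub>v coord w) \<bullet>c coord w)" by (simp add: coord_def)
next
  fix v :: "complex Matrix.vec" assume "\<forall>w. 0 \<le> Re ((A *\<^sub>v coord w) \<bullet>c coord w)" "v \<in> carrier_vec k"
  then show "0 \<le> Re ((A *\<^sub>v v) \<bullet>c v)" using coord_comb by metis
qed

section \<open>Properties inherited by compressions\<close>

lemma op_selfadjoint_compress:
  assumes "bounded_clinear f" "op_selfadjoint f"
  shows "op_selfadjoint (mop (compress f))"
  using assms by (simp add: op_selfadjoint_def mop_compress proj_cinner)

lemma op_nonneg_compress:
  assumes "bounded_clinear f" "op_nonneg f"
  shows "op_nonneg (mop (compress f))"
  using assms op_selfadjoint_compress[OF assms(1)] by (simp add: op_nonneg_def mop_compress proj_cinner)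

lemma norm_mop_compress_le:
  assumes "bounded_clinear f" "\<And>v. norm (f v) \<le> R * norm v" "0 \<le> R"
  shows "norm (mop (compress f) w) \<le> R * norm w"
  unfolding mop_compress[OF assms(1)]
  by (meson assms(2,3) mult_left_mono norm_proj_le order_trans)

lemma mat_adjoint_compress:
  assumes "bounded_clinear f"
  shows "mat_adjoint (compress f) = compress (op_adjoint f)"
proof (rule eq_matI)
  show "mat_adjoint (compress f) $$ (a, b) = compress (op_adjoint f) $$ (a, b)"
    if "a < dim_row (compress (op_adjoint f))" "b < dim_col (compress (op_adjoint f))" for a b
    using that
    by (simp add: compress_def mat_adjoint_index[of _ k] op_adjoint[OF assms] cinner_commute[of "e _"])
qed (use mat_adjoint_carrier[OF compress_carrier, of f] compress_carrier[of "op_adjoint f"] in \<open>auto simp del: compress_carrier\<close>)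

section \<open>Polynomials and words in matrices as operators\<close>

lemma mop_linear_combination:
  "mop (mat k k (\<lambda>(a, b). \<Sum>i\<in>I. c i * M i $$ (a, b))) w = (\<Sum>i\<in>I. scaleC (c i) (mop (M i) w))"
proof -
  have "mop (mat k k (\<lambda>(a, b). \<Sum>i\<in>I. c i * M i $$ (a, b))) w
      = (\<Sum>a<k. \<Sum>b<k. \<Sum>i\<in>I. scaleC (c i * M i $$ (a, b) * cinner w (e b)) (e a))"
    unfolding mop_def by (intro sum.cong) (simp_all add: sum_distrib_right scaleC_sum_left)
  also have "\<dots> = (\<Sum>i\<in>I. \<Sum>a<k. \<Sum>b<k. scaleC (c i * M i $$ (a, b) * cinner w (e b)) (e a))"
    by (simp add: sum.swap[of _ I])
  also have "\<dots> = (\<Sum>i\<in>I. scaleC (c i) (mop (M i) w))"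
    by (simp add: mop_def scaleC_sum_right scaleC_scaleC mult.assoc)
  finally show ?thesis .
qed

lemma mop_pow:
  assumes "A \<in> carrier_mat k k"
  shows "mop (A ^\<^sub>m i) w = (mop A ^^ i) (proj w)"
proof (induction i arbitrary: w)
  case 0
  have "dim_row A = k" using assms by simp
  then show ?case by (simp add: mop_one)
next
  case (Suc i)
  have "A ^\<^sub>m i \<in> carrier_mat k k" using assms by simp
  then show ?case using Suc.IH[of "mop A w"]
    by (simp add: mop_mult assms funpow_swap1 del: funpow.simps(2)) (simp add: funpow_swap1)
qed

lemma mop_mat_poly:
  assumes "A \<in> carrier_mat k k"
  shows "mop (mat_poly k q A) w = op_poly q (mop A) (proj w)"
  unfolding mat_poly_def mop_linear_combination op_poly_def
  by (simp add: mop_pow[OF assms] scaleC_of_real)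

lemma proj_op_poly:
  assumes "\<And>u. proj u = u \<Longrightarrow> proj (f u) = f u" "proj w = w"
  shows "proj (op_poly q f w) = op_poly q f w"
proof -
  have "proj ((f ^^ i) w) = (f ^^ i) w" for i by (induction i) (simp_all add: assms)
  then show ?thesis
    by (simp add: op_poly_def bounded_clinear_simps[OF bounded_clinear_proj])
qed

lemma mat_word_carrier:
  assumes "\<And>l. l \<in> set w \<Longrightarrow> Y (letter_index l) \<in> carrier_mat k k"
  shows "mat_word k Y w \<in> carrier_mat k k"
  using assms
proof (induction w)
  case (Cons l w)
  have "mat_letter Y l \<in> carrier_mat k k"
    using Cons.prems[of l] by (cases l) (auto intro: mat_adjoint_carrier)
  then show ?case using Cons by auto
qed simp

lemma mop_mat_word:
  assumes "\<And>l. l \<in> set w \<Longrightarrow> Y (letter_index l) \<in> carrier_mat k k"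
  shows "mop (mat_word k Y w) u = op_word (\<lambda>i. mop (Y i)) w (proj u)"
  using assms
proof (induction w)
  case Nil
  then show ?case by (simp add: mop_one)
next
  case (Cons l w)
  have "mat_letter Y l \<in> carrier_mat k k" "mop (mat_letter Y l) = op_letter (\<lambda>i. mop (Y i)) l"
    using Cons.prems[of l] by (cases l; auto intro: mat_adjoint_carrier simp: op_adjoint_mop)+
  moreover have "mat_word k Y w \<in> carrier_mat k k" using Cons.prems by (intro mat_word_carrier) auto
  ultimately show ?case using Cons by (simp add: mop_mult)
qed

lemma mop_mat_eval:
  assumes "star_poly_in m p" "\<And>i. i \<in> {1..m} \<Longrightarrow> Y i \<in> carrier_mat k k"
  shows "mop (mat_eval k p Y) u = op_eval p (\<lambda>i. mop (Y i)) (proj u)"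
  unfolding mat_eval_def mop_linear_combination op_eval_def
proof (rule sum.cong[OF refl])
  fix w assume "w \<in> Poly_Mapping.keys p"
  then have "mop (mat_word k Y w) u = op_word (\<lambda>i. mop (Y i)) w (proj u)"
    using assms by (intro mop_mat_word) (auto simp: star_poly_in_def)
  then show "scaleC (Poly_Mapping.lookup p w) (mop (mat_word k Y w) u)
      = scaleC (Poly_Mapping.lookup p w) (op_word (\<lambda>i. mop (Y i)) w (proj u))" by simp
qed

section \<open>Functional calculus of a nonnegative matrix\<close>

text \<open>An eigenvector of \<open>A\<close>, read as coordinates in the frame, is an eigenvector
  of \<open>mop A\<close> and so rules out a bounded inverse. The eigenvector itself serves later to
  show that eigenvalues of self-adjoint matrices are real.\<close>

lemma spectrum_subset_op_spectrum:
  assumes A: "A \<in> carrier_mat k k" and z: "z \<in> spectrum A"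
  shows "z \<in> op_spectrum (mop A)" "\<exists>w. proj w = w \<and> w \<noteq> 0 \<and> mop A w = scaleC z w"
proof -
  obtain v where v: "v \<in> carrier_vec k" "v \<noteq> 0\<^sub>v k" "A *\<^sub>v v = z \<cdot>\<^sub>v v"
    using z A by (auto simp: spectrum_def eigenvalue_def eigenvector_def)
  have ne: "comb v \<noteq> 0"
  proof
    assume "comb v = 0"
    then have "v = coord 0" using coord_comb[OF v(1)] by simp
    also have "\<dots> = 0\<^sub>v k" by (rule eq_vecI) (simp_all add: coord_def)
    finally show False using v by simp
  qed
  have eq: "mop A (comb v) = scaleC z (comb v)"
  proof (rule frame_eqI)
    fix a assume a: "a < k"
    have "cinner (mop A (comb v)) (e a) = (\<Sum>b<k. A $$ (a, b) * vec_index v b)"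
      unfolding cinner_mop[OF a] by (rule sum.cong) (simp_all add: comb_def cinner_frame_sum)
    also have "\<dots> = vec_index (A *\<^sub>v v) a"
      using a A v(1) by (simp add: scalar_prod_def atLeast0LessThan)
    also have "\<dots> = cinner (scaleC z (comb v)) (e a)"
      using a v by (simp add: v(3) cinner_scaleC_left comb_def cinner_frame_sum)
    finally show "cinner (mop A (comb v)) (e a) = cinner (scaleC z (comb v)) (e a)" .
  qed (simp_all add: bounded_clinear_scaleC[OF bounded_clinear_proj])
  show "\<exists>w. proj w = w \<and> w \<noteq> 0 \<and> mop A w = scaleC z w"
    using ne eq by (intro exI[of _ "comb v"]) simp
  show "z \<in> op_spectrum (mop A)"
  proof (rule ccontr)
    assume "z \<notin> op_spectrum (mop A)"
    then obtain g where g: "bounded_clinear g" "\<And>u. g (scaleC z u - mop A u) = u"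
      by (auto simp: op_spectrum_def)
    from g(2)[of "comb v"] show False using ne by (simp add: eq bounded_clinear_zero[OF g(1)])
  qed
qed

text \<open>Unless the frame is a basis of the whole space, \<open>0\<close> is in the spectrum of \<open>mop A\<close> even if it
  is not an eigenvalue of \<open>A\<close>. Extending \<open>mop A\<close> by an eigenvalue \<open>\<mu>\<close> of \<open>A\<close> instead of by \<open>0\<close> on
  the orthogonal complement avoids this.\<close>

lemma op_spectrum_extension:
  assumes A: "A \<in> carrier_mat k k" and \<mu>: "\<mu> \<in> spectrum A" and z: "z \<notin> spectrum A"
  shows "z \<notin> op_spectrum (\<lambda>w. mop A w + scaleC \<mu> (w - proj w))"
proof -
  define C where "C = z \<cdot>\<^sub>m 1\<^sub>m k - A"
  have C: "C \<in> carrier_mat k k" unfolding C_def by (rule minus_carrier_mat[OF A])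
  have "char_matrix A z = (-1) \<cdot>\<^sub>m C" using A by (intro eq_matI) (auto simp: char_matrix_def C_def)
  then have "Determinant.det (char_matrix A z) = (-1) ^ k * Determinant.det C"
    using C by simp
  moreover have "Determinant.det (char_matrix A z) \<noteq> 0"
    using z eigenvalue_det[OF A] by (simp add: spectrum_def)
  ultimately have "Determinant.det C \<noteq> 0" by auto
  from det_non_zero_imp_unit[OF C this, of "()"]
  obtain B where B: "B \<in> carrier_mat k k" "B * C = 1\<^sub>m k" "C * B = 1\<^sub>m k"
    by (auto simp: Units_def ring_mat_def)
  have mopC: "mop C w = scaleC z (proj w) - mop A w" for w
  proof (rule frame_eqI)
    fix a assume a: "a < k"
    have "(\<Sum>b<k. C $$ (a, b) * cinner w (e b))
        = (\<Sum>b<k. (if b = a then z * cinner w (e b) else 0) - A $$ (a, b) * cinner w (e b))"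
      using a A by (intro sum.cong) (auto simp: C_def left_diff_distrib)
    then show "cinner (mop C w) (e a) = cinner (scaleC z (proj w) - mop A w) (e a)"
      using a by (simp add: cinner_mop cinner_diff_left cinner_scaleC_left cinner_proj sum_subtractf)
  qed (simp_all add: bounded_clinear_simps[OF bounded_clinear_proj])
  have BC: "mop B (mop C w) = proj w" "mop C (mop B w) = proj w" for w
    using mop_mult[OF B(1) C, of w] mop_mult[OF C B(1), of w] B by (simp_all add: mop_one)
  have z\<mu>: "z - \<mu> \<noteq> 0" using \<mu> z by auto
  define T where "T w = mop A w + scaleC \<mu> (w - proj w)" for w
  have T: "scaleC z w - T w = mop C w + scaleC (z - \<mu>) (w - proj w)" for w
    by (simp add: T_def mopC scaleC_diff_left scaleC_diff_right algebra_simps)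
  \<comment> \<open>The inverse is built blockwise: \<open>B\<close> on the span of the frame,
    division by \<open>z - \<mu>\<close> on the complement.\<close>
  define g where "g w = mop B w + scaleC (inverse (z - \<mu>)) (w - proj w)" for w
  have "bounded_clinear g"
    unfolding g_def by (intro bounded_clinear_plus bounded_clinear_mop bounded_clinear_const_scaleC
        bounded_clinear_minus bounded_clinear_id bounded_clinear_proj)
  moreover have mop0: "mop M (w - proj w) = 0" for M w
    by (simp add: bounded_clinear_diff[OF bounded_clinear_mop])
  have "g (scaleC z w - T w) = w" for w
    unfolding T g_def using z\<mu>
    by (simp add: bounded_clinear_add[OF bounded_clinear_mop] bounded_clinear_scaleC[OF bounded_clinear_mop]
        bounded_clinear_add[OF bounded_clinear_proj] bounded_clinear_diff[OF bounded_clinear_proj]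
        bounded_clinear_scaleC[OF bounded_clinear_proj] mop0 BC scaleC_scaleC)
  moreover have "scaleC z (g w) - T (g w) = w" for w
    unfolding T unfolding g_def using z\<mu>
    by (simp add: bounded_clinear_add[OF bounded_clinear_mop] bounded_clinear_scaleC[OF bounded_clinear_mop]
        bounded_clinear_add[OF bounded_clinear_proj] bounded_clinear_diff[OF bounded_clinear_proj]
        bounded_clinear_scaleC[OF bounded_clinear_proj] mop0 BC scaleC_scaleC)
  ultimately show ?thesis unfolding T_def[abs_def, symmetric] op_spectrum_def by blast
qed

text \<open>The entry is a matrix coefficient of \<open>op_poly q T\<close>, where \<open>T\<close>
  extends \<open>mop A\<close> by an eigenvalue on the complement. The operator spectrum of
  \<open>T\<close> lies in \<open>spectrum A\<close>, so a bound for \<open>q\<close> on the matrix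
  spectrum suffices, even when 0 is not in it.\<close>

lemma mat_poly_entry_le:
  assumes A: "A \<in> carrier_mat k k" and sa: "mat_selfadjoint A" and M: "0 \<le> M"
    and q: "\<And>s. complex_of_real s \<in> spectrum A \<Longrightarrow> \<bar>poly q s\<bar> \<le> M"
    and ab: "a < k" "b < k"
  shows "cmod (mat_poly k q A $$ (a, b)) \<le> M"
proof -
  have sa': "op_selfadjoint (mop A)" using sa mat_selfadjoint_iff_mop[OF A] by simp
  \<comment> \<open>\<open>a < k\<close> makes the size positive, so an eigenvalue exists; the next
    steps show it to be real, as self-adjointness of \<open>T\<close> requires.\<close>
  obtain \<mu> where \<mu>: "\<mu> \<in> spectrum A" using spectrum_non_empty[OF A] ab by auto
  obtain w where w: "w \<noteq> 0" "mop A w = scaleC \<mu> w" using spectrum_subset_op_spectrum(2)[OF A \<mu>] by blast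
  have "\<bar>Im \<mu>\<bar> * norm w \<le> 0" using op_selfadjoint_bounded_below[OF sa', of \<mu> w] w by simp
  then have "Im \<mu> = 0" using w by (simp add: mult_le_0_iff)
  then have cnj\<mu>: "cnj \<mu> = \<mu>" by (simp add: complex_eq_iff)
  define T where "T w = mop A w + scaleC \<mu> (w - proj w)" for w
  have T: "bounded_clinear T"
    unfolding T_def by (intro bounded_clinear_plus bounded_clinear_mop bounded_clinear_const_scaleC
        bounded_clinear_minus bounded_clinear_id bounded_clinear_proj)
  have Tsa: "op_selfadjoint T"
    using sa' by (simp add: op_selfadjoint_def T_def cinner_add_left cinner_add_right cinner_scaleC_left
        cinner_scaleC_right cnj\<mu> cinner_diff_left cinner_diff_right proj_cinner)
  \<comment> \<open>On the span of the frame \<open>T\<close> and \<open>mop A\<close> have the same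
    iterates, so entries do not see the extension.\<close>
  have TE: "(T ^^ i) (e b) = (mop A ^^ i) (e b) \<and> proj ((mop A ^^ i) (e b)) = (mop A ^^ i) (e b)" for i
    by (induction i) (auto simp: proj_e[OF ab(2)] T_def)
  have "mat_poly k q A $$ (a, b) = cinner (mop (mat_poly k q A) (e b)) (e a)"
    by (rule mop_entry[symmetric]) (use ab in auto)
  also have "mop (mat_poly k q A) (e b) = op_poly q T (e b)"
    unfolding mop_mat_poly[OF A] proj_e[OF ab(2)] op_poly_def by (simp add: TE)
  also have "cmod (cinner (op_poly q T (e b)) (e a)) \<le> norm (op_poly q T (e b)) * norm (e a)"
    by (rule cinner_Cauchy_Schwarz)
  also have "\<dots> \<le> M * norm (e b) * norm (e a)"
  proof (intro mult_right_mono norm_op_poly_le[OF T Tsa M] q)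
    show "complex_of_real s \<in> spectrum A" if "complex_of_real s \<in> op_spectrum T" for s
      using op_spectrum_extension[OF A \<mu>, of "complex_of_real s"] that unfolding T_def by blast
  qed simp
  also have "\<dots> = M"
  proof -
    have "norm (e c) = 1" if "c < k" for c
    proof -
      have "complex_of_real ((norm (e c))\<^sup>2) = complex_of_real 1" using ortho[OF that that] by (simp add: cinner_self)
      then have "(norm (e c))\<^sup>2 = 1" by (simp only: of_real_eq_iff)
      then show ?thesis by (simp add: power2_eq_1_iff) (metis norm_ge_zero not_one_le_zero neg_0_le_iff_le)
    qed
    then show ?thesis using ab by simp
  qed
  finally show ?thesis .
qed

text \<open>The compressed operator calculus satisfies the defining property of
  \<open>mat_cfc\<close> because \<open>spectrum A\<close> lies in \<open>{0..R}\<close>. Uniqueness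
  is the delicate half and rests on \<open>mat_poly_entry_le\<close>.\<close>

lemma mat_cfc_eq:
  assumes A: "A \<in> carrier_mat k k" and pos: "mat_nonneg k A"
    and R: "\<And>v. norm (mop A v) \<le> R * norm v" "0 \<le> R" and h: "continuous_on {0..R} h"
  shows "mat_cfc k h A = compress (op_cfc h (mop A))"
proof -
  define B where "B = compress (op_cfc h (mop A))"
  have pos': "op_nonneg (mop A)" using pos mat_nonneg_iff_mop[OF A] by simp
  have sa: "mat_selfadjoint A" using pos by (simp add: mat_nonneg_def)
  have spec: "{s. complex_of_real s \<in> spectrum A} \<subseteq> {0..R}"
    using op_spectrum_nonneg[OF bounded_clinear_mop pos' R] spectrum_subset_op_spectrum(1)[OF A] by auto
  obtain Q where Q: "uniform_limit {0..R} (\<lambda>l. poly (Q l)) h sequentially"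
    using polynomials_uniform_limit[OF h] by blast
  have conv: "(\<lambda>l. mat_poly k (Q l) A $$ (a, b)) \<longlonglongrightarrow> B $$ (a, b)" if ab: "a < k" "b < k" for a b
  proof -
    have "(\<lambda>l. op_poly (Q l) (mop A) (e b)) \<longlonglongrightarrow> op_cfc h (mop A) (e b)"
    proof (rule tendstoI)
      fix \<epsilon> :: real assume "0 < \<epsilon>"
      define d where "d = \<epsilon> / (norm (e b) + 1)"
      have "0 < norm (e b) + 1" by (simp add: add_nonneg_pos)
      then have d: "d > 0" "d * norm (e b) < \<epsilon>" using \<open>0 < \<epsilon>\<close> by (simp_all add: d_def field_simps)
      show "\<forall>\<^sub>F l in sequentially. dist (op_poly (Q l) (mop A) (e b)) (op_cfc h (mop A) (e b)) < \<epsilon>"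
        using uniform_limitD[OF Q d(1)]
      proof eventually_elim
        case (elim l)
        have "norm (op_poly (Q l) (mop A) (e b) - op_cfc h (mop A) (e b)) \<le> d * norm (e b)"
          by (rule op_cfc_approx[OF bounded_clinear_mop pos' R h])
            (use elim in \<open>auto simp: dist_real_def less_imp_le\<close>)
        then show ?case using d(2) by (simp add: dist_norm)
      qed
    qed
    then have "(\<lambda>l. cinner (op_poly (Q l) (mop A) (e b)) (e a)) \<longlonglongrightarrow> cinner (op_cfc h (mop A) (e b)) (e a)"
      by (intro tendsto_cinner tendsto_const)
    moreover have "cinner (op_poly (Q l) (mop A) (e b)) (e a) = mat_poly k (Q l) A $$ (a, b)" for l
      using mop_entry[OF ab, of "mat_poly k (Q l) A"] by (simp add: mop_mat_poly[OF A] proj_e[OF ab(2)])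
    ultimately show ?thesis using ab by (simp add: B_def compress_def)
  qed
  have "mat_cfc k h A = B"
    unfolding mat_cfc_def
  proof (rule the_equality)
    show "B \<in> carrier_mat k k \<and> (\<exists>q :: nat \<Rightarrow> real poly.
       uniform_limit {s. complex_of_real s \<in> spectrum A} (\<lambda>l. poly (q l)) h sequentially \<and>
       (\<forall>a<k. \<forall>b<k. (\<lambda>l. mat_poly k (q l) A $$ (a, b)) \<longlonglongrightarrow> B $$ (a, b)))"
      using conv uniform_limit_on_subset[OF Q spec] by (auto simp: B_def)
    fix B' assume "B' \<in> carrier_mat k k \<and> (\<exists>q :: nat \<Rightarrow> real poly.
       uniform_limit {s. complex_of_real s \<in> spectrum A} (\<lambda>l. poly (q l)) h sequentially \<and>
       (\<forall>a<k. \<forall>b<k. (\<lambda>l. mat_poly k (q l) A $$ (a, b)) \<longlonglongrightarrow> B' $$ (a, b)))"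
    then obtain q :: "nat \<Rightarrow> real poly" where B': "B' \<in> carrier_mat k k"
      and q: "uniform_limit {s. complex_of_real s \<in> spectrum A} (\<lambda>l. poly (q l)) h sequentially"
      and lim: "\<And>a b. a < k \<Longrightarrow> b < k \<Longrightarrow> (\<lambda>l. mat_poly k (q l) A $$ (a, b)) \<longlonglongrightarrow> B' $$ (a, b)" by blast
    show "B' = B"
    proof (rule eq_matI)
      fix a b assume "a < dim_row B" "b < dim_col B"
      then have ab: "a < k" "b < k" by (simp_all add: B_def compress_def)
      \<comment> \<open>The rival \<open>q\<close> converges only on \<open>spectrum A\<close>,
        perhaps not at 0, which may lie in the operator spectrum of \<open>mop A\<close>; hence the
        entrywise bound instead of uniqueness of \<open>op_cfc\<close>.\<close>
      have "(\<lambda>l. mat_poly k (Q l) A $$ (a, b) - mat_poly k (q l) A $$ (a, b)) \<longlonglongrightarrow> 0"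
      proof (rule tendstoI)
        fix \<epsilon> :: real assume "0 < \<epsilon>"
        then have d: "\<epsilon> / 4 > 0" by simp
        show "\<forall>\<^sub>F l in sequentially. dist (mat_poly k (Q l) A $$ (a, b) - mat_poly k (q l) A $$ (a, b)) 0 < \<epsilon>"
          using uniform_limitD[OF Q d] uniform_limitD[OF q d]
        proof eventually_elim
          case (elim l)
          have "\<bar>poly (Q l - q l) s\<bar> \<le> \<epsilon> / 2" if "complex_of_real s \<in> spectrum A" for s
          proof -
            have "dist (poly (Q l) s) (h s) < \<epsilon> / 4" "dist (poly (q l) s) (h s) < \<epsilon> / 4"
              using elim that spec by auto
            then show ?thesis unfolding dist_real_def poly_diff by linarith
          qed
          then have "cmod (mat_poly k (Q l - q l) A $$ (a, b)) \<le> \<epsilon> / 2"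
            using \<open>0 < \<epsilon>\<close> by (intro mat_poly_entry_le[OF A sa _ _ ab]) auto
          also have "mat_poly k (Q l - q l) A $$ (a, b) = mat_poly k (Q l) A $$ (a, b) - mat_poly k (q l) A $$ (a, b)"
            by (simp add: mop_entry[OF ab, symmetric] mop_mat_poly[OF A] op_poly_diff[OF bounded_clinear_mop]
                cinner_diff_left)
          finally show ?case using \<open>0 < \<epsilon>\<close> by simp
        qed
      qed
      then have "(\<lambda>l. mat_poly k (Q l) A $$ (a, b)) \<longlonglongrightarrow> B' $$ (a, b)"
        using tendsto_add[OF _ lim[OF ab], of "\<lambda>l. mat_poly k (Q l) A $$ (a, b) - mat_poly k (q l) A $$ (a, b)" 0] by simp
      then show "B' $$ (a, b) = B $$ (a, b)" using conv[OF ab] LIMSEQ_unique by blast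
    qed (use B' in \<open>auto simp: B_def compress_def\<close>)
  qed
  then show ?thesis by (simp add: B_def)
qed

end

section \<open>Powers of compressions\<close>

lemma cinner_funpow:
  fixes f g :: "'h::complex_hilbert_space \<Rightarrow> 'h"
  assumes "\<And>v w. cinner (f v) w = cinner v (g w)"
  shows "cinner ((f ^^ i) v) w = cinner v ((g ^^ i) w)"
proof (induction i arbitrary: v)
  case (Suc i)
  then show ?case by (simp add: funpow_swap1 assms)
qed simp

lemma norm_funpow_le:
  fixes f :: "'a::real_normed_vector \<Rightarrow> 'a"
  assumes "\<And>v. norm (f v) \<le> R * norm v" "0 \<le> R"
  shows "norm ((f ^^ i) v) \<le> R ^ i * norm v"
proof (induction i)
  case (Suc i)
  have "norm (f ((f ^^ i) v)) \<le> R * norm ((f ^^ i) v)" by (rule assms)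
  also have "\<dots> \<le> R * (R ^ i * norm v)" using Suc assms(2) by (rule mult_left_mono)
  finally show ?case by (simp add: mult.assoc)
qed simp

lemma op_adjoint_funpow:
  "bounded_clinear f \<Longrightarrow> op_adjoint (f ^^ i) = op_adjoint f ^^ i"
  by (rule op_adjoint_eqI, rule cinner_funpow, rule op_adjoint)

lemma continuous_on_powr_Icc:
  "0 < t \<Longrightarrow> continuous_on {0..R} (\<lambda>s::real. s powr t)"
  by (intro continuous_on_powr' continuous_on_id continuous_on_const) auto

lemma bounded_clinear_op_power:
  assumes f: "bounded_clinear f" and t: "t > 0" "t \<notin> \<int> \<Longrightarrow> op_nonneg f"
  shows "bounded_clinear (op_power f t)"
proof (cases "t \<in> \<int>")
  case False
  obtain R where R: "0 \<le> R" "\<And>v. norm (f v) \<le> R * norm v" using bounded_clinear_bound[OF f] by blast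
  show ?thesis
    using bounded_clinear_op_cfc[OF f t(2)[OF False] R(2,1) continuous_on_powr_Icc[OF t(1)]] False
    by (simp add: op_power_def)
qed (simp add: op_power_def bounded_clinear_funpow f)

context orthonormal_frame
begin

text \<open>This is the power of the compression, not the compression of the power; the two differ
  in general, and only the former is reached by the matrix hypothesis.\<close>

definition power_compression :: "('h \<Rightarrow> 'h) \<Rightarrow> real \<Rightarrow> 'h \<Rightarrow> 'h" where
  "power_compression f t = mop (mat_power k (compress f) t)"

lemma bounded_clinear_power_compression: "bounded_clinear (power_compression f t)"
  unfolding power_compression_def by (rule bounded_clinear_mop)

lemma proj_mop_funpow: "proj ((mop A ^^ i) w) = (mop A ^^ i) (proj w)"
proof (induction i)
  case (Suc i)
  then show ?case using mop_proj[of A "(mop A ^^ i) w"] by simp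
qed simp

lemma power_compression_int:
  assumes "t \<in> \<int>"
  shows "power_compression f t = (\<lambda>w. (mop (compress f) ^^ nat \<lfloor>t\<rfloor>) (proj w))"
  using assms mop_pow[OF compress_carrier] by (auto simp: power_compression_def mat_power_def)

text \<open>Reduces a starred letter with integer exponent to an unstarred one for the adjoint
  operator, whose orbit is also in the frame.\<close>

lemma op_adjoint_power_compression_int:
  assumes f: "bounded_clinear f" and t: "t \<in> \<int>"
  shows "op_adjoint (power_compression f t) = power_compression (op_adjoint f) t"
proof (rule op_adjoint_eqI)
  fix v w
  have "cinner (mop (compress f) v) w = cinner v (mop (compress (op_adjoint f)) w)" for v w
    using mop_cinner[OF compress_carrier] mat_adjoint_compress[OF f] by simp
  then show "cinner (power_compression f t v) w = cinner v (power_compression (op_adjoint f) t w)"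
    unfolding power_compression_int[OF t] proj_mop_funpow[symmetric]
    by (simp add: proj_cinner cinner_funpow[of "mop (compress f)" "mop (compress (op_adjoint f))"])
      (simp add: proj_mop_funpow cinner_funpow flip: proj_cinner)
qed

text \<open>While the orbit stays in the span of the frame, the projections cut nothing off.\<close>

lemma mop_compress_funpow:
  assumes "bounded_clinear f" "\<And>i. i \<le> d \<Longrightarrow> proj ((f ^^ i) u) = (f ^^ i) u" "i \<le> d"
  shows "(mop (compress f) ^^ i) u = (f ^^ i) u"
  using assms(3)
proof (induction i)
  case (Suc i)
  then show ?case using assms(2)[of i] assms(2)[of "Suc i"] by (simp add: mop_compress[OF assms(1)])
qed simp

lemma op_poly_compress:
  assumes "bounded_clinear f" "\<And>i. i \<le> degree q \<Longrightarrow> proj ((f ^^ i) u) = (f ^^ i) u"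
  shows "op_poly q (mop (compress f)) u = op_poly q f u"
  unfolding op_poly_def using mop_compress_funpow[OF assms] by simp

lemma mat_power_carrier:
  assumes f: "bounded_clinear f" and t: "t > 0" "t \<notin> \<int> \<Longrightarrow> op_nonneg f"
  shows "mat_power k (compress f) t \<in> carrier_mat k k"
proof (cases "t \<in> \<int>")
  case False
  obtain R where R: "0 \<le> R" "\<And>v. norm (f v) \<le> R * norm v" using bounded_clinear_bound[OF f] by blast
  have "mat_nonneg k (compress f)"
    using op_nonneg_compress[OF f t(2)[OF False]] by (simp add: mat_nonneg_iff_mop)
  from mat_cfc_eq[OF compress_carrier this norm_mop_compress_le[OF f R(2,1)] R(1) continuous_on_powr_Icc[OF t(1)]]
  show ?thesis using False by (simp add: mat_power_def)
qed (simp add: mat_power_def pow_carrier_mat)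

text \<open>The factor 2 counts two approximations by the same \<open>q\<close>, one for the power
  of the compression and one for the power of \<open>f\<close>. In between, \<open>q\<close> of the
  compression and \<open>q\<close> of \<open>f\<close> coincide at \<open>w\<close>.\<close>

lemma power_compression_nonint:
  assumes f: "bounded_clinear f" and pos: "op_nonneg f" and R: "\<And>v. norm (f v) \<le> R * norm v" "0 \<le> R"
    and t: "t > 0" "t \<notin> \<int>"
  shows op_selfadjoint_power_compression: "op_selfadjoint (power_compression f t)"
    and norm_power_compression_le: "norm (power_compression f t w) \<le> R powr t * norm w"
    and power_compression_approx:
      "\<lbrakk>\<And>s. s \<in> {0..R} \<Longrightarrow> \<bar>poly q s - s powr t\<bar> \<le> \<epsilon>;
        \<And>i. i \<le> degree q \<Longrightarrow> proj ((f ^^ i) w) = (f ^^ i) w\<rbrakk>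
       \<Longrightarrow> norm (power_compression f t w - op_power f t w) \<le> 2 * \<epsilon> * norm w"
proof -
  define T where "T = mop (compress f)"
  have T: "bounded_clinear T" "op_nonneg T" "\<And>v. norm (T v) \<le> R * norm v"
    unfolding T_def using op_nonneg_compress[OF f pos] norm_mop_compress_le[OF f R]
    by (auto intro: bounded_clinear_mop)
  note h = continuous_on_powr_Icc[OF t(1), of R]
  define g where "g = op_cfc (\<lambda>s. s powr t) T"
  have g: "bounded_clinear g" "op_selfadjoint g"
    unfolding g_def using bounded_clinear_op_cfc[OF T R(2) h] op_selfadjoint_op_cfc[OF T R(2) h] by auto
  have approx: "norm (op_poly q T w - g w) \<le> \<epsilon> * norm w"
    if "\<And>s. s \<in> {0..R} \<Longrightarrow> \<bar>poly q s - s powr t\<bar> \<le> \<epsilon>" for q \<epsilon> w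
    unfolding g_def by (rule op_cfc_approx[OF T R(2) h]) (rule that)
  have "mat_nonneg k (compress f)" using T(2) by (simp add: mat_nonneg_iff_mop T_def)
  from mat_cfc_eq[OF compress_carrier this T(3)[unfolded T_def] R(2) h]
  have pc: "power_compression f t w = proj (g (proj w))" for w
    using t by (simp add: power_compression_def mat_power_def mop_compress[OF g(1)] g_def[symmetric] T_def[symmetric])
  show "op_selfadjoint (power_compression f t)"
    using g(2) by (simp add: op_selfadjoint_def pc proj_cinner)
  show "norm (power_compression f t w) \<le> R powr t * norm w"
  proof -
    \<comment> \<open>The zero polynomial is within \<open>R powr t\<close> of the power function on
      \<open>{0..R}\<close>, so the approximation estimate doubles as a norm bound.\<close>
    have "norm (op_poly 0 T (proj w) - g (proj w)) \<le> R powr t * norm (proj w)"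
      by (rule approx) (use t in \<open>auto intro: powr_mono2\<close>)
    then have "norm (g (proj w)) \<le> R powr t * norm (proj w)" by (simp add: op_poly_def)
    also have "\<dots> \<le> R powr t * norm w" by (intro mult_left_mono norm_proj_le) simp
    finally show ?thesis unfolding pc using norm_proj_le order_trans by blast
  qed
  show "norm (power_compression f t w - op_power f t w) \<le> 2 * \<epsilon> * norm w"
    if q: "\<And>s. s \<in> {0..R} \<Longrightarrow> \<bar>poly q s - s powr t\<bar> \<le> \<epsilon>"
      and E: "\<And>i. i \<le> degree q \<Longrightarrow> proj ((f ^^ i) w) = (f ^^ i) w"
  proof -
    have w: "proj w = w" using E[of 0] by simp
    have "proj (op_poly q T w) = op_poly q T w"
      by (rule proj_op_poly) (simp_all add: T_def w)
    then have "power_compression f t w - op_poly q T w = proj (g w - op_poly q T w)"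
      by (simp add: pc w bounded_clinear_diff[OF bounded_clinear_proj])
    then have "norm (power_compression f t w - op_poly q T w) \<le> \<epsilon> * norm w"
      using norm_proj_le[of "g w - op_poly q T w"] approx[OF q, of w] by (simp add: norm_minus_commute)
    moreover have "norm (op_poly q f w - op_power f t w) \<le> \<epsilon> * norm w"
      using op_cfc_approx[OF f pos R h, of q \<epsilon> w] q t by (simp add: op_power_def)
    moreover have "op_poly q T w = op_poly q f w"
      unfolding T_def by (rule op_poly_compress[OF f E])
    ultimately show ?thesis
      using norm_triangle_ineq[of "power_compression f t w - op_poly q T w" "op_poly q f w - op_power f t w"]
      by simp
  qed
qed

end

text \<open>Compressing increases neither the norm nor destroys positivity, so a norm bound
  \<open>R\<close> of \<open>f\<close> gives a constant valid for every frame.\<close>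

lemma power_compression_uniformly_bounded:
  assumes f: "bounded_clinear f" and t: "t > 0" "t \<notin> \<int> \<Longrightarrow> op_nonneg f"
  shows "\<exists>C\<ge>0. \<forall>e k w. orthonormal_frame e k \<longrightarrow> norm (orthonormal_frame.power_compression e k f t w) \<le> C * norm w"
proof -
  obtain R where R: "0 \<le> R" "\<And>v. norm (f v) \<le> R * norm v" using bounded_clinear_bound[OF f] by blast
  show ?thesis
  proof (cases "t \<in> \<int>")
    case True
    have "norm (orthonormal_frame.power_compression e k f t w) \<le> R ^ nat \<lfloor>t\<rfloor> * norm w"
      if "orthonormal_frame e k" for e k w
    proof -
      interpret orthonormal_frame e k by (rule that)
      have "norm (power_compression f t w) \<le> R ^ nat \<lfloor>t\<rfloor> * norm (proj w)"
        unfolding power_compression_int[OF True]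
        by (rule norm_funpow_le[OF norm_mop_compress_le[OF f R(2,1)] R(1)])
      also have "\<dots> \<le> R ^ nat \<lfloor>t\<rfloor> * norm w" using R by (intro mult_left_mono norm_proj_le) simp
      finally show ?thesis .
    qed
    then show ?thesis using R(1) by (intro exI[of _ "R ^ nat \<lfloor>t\<rfloor>"]) simp
  next
    case False
    then show ?thesis
      using orthonormal_frame.norm_power_compression_le[OF _ f t(2)[OF False] R(2,1) t(1) False]
      by (intro exI[of _ "R powr t"]) simp
  qed
qed

text \<open>\<open>d\<close> depends on \<open>u\<close> and \<open>\<epsilon>\<close> but not on
  the frame. For integer \<open>t\<close> it is the exponent, and both differences vanish. Otherwise
  it is the degree of an approximating polynomial, and the adjoints add nothing since both powers
  are self-adjoint.\<close>

lemma power_compression_eventually_close: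
  fixes f :: "'h::complex_hilbert_space \<Rightarrow> 'h"
  assumes f: "bounded_clinear f" and t: "t > 0" "t \<notin> \<int> \<Longrightarrow> op_nonneg f" and "\<epsilon> > 0"
  shows "\<exists>d. \<forall>e k. orthonormal_frame e k \<longrightarrow>
    (\<forall>i\<le>d. orthonormal_frame.proj e k ((f ^^ i) u) = (f ^^ i) u \<and>
            orthonormal_frame.proj e k ((op_adjoint f ^^ i) u) = (op_adjoint f ^^ i) u) \<longrightarrow>
    norm (orthonormal_frame.power_compression e k f t u - op_power f t u) < \<epsilon> \<and>
    norm (op_adjoint (orthonormal_frame.power_compression e k f t) u - op_adjoint (op_power f t) u) < \<epsilon>"
proof (cases "t \<in> \<int>")
  case True
  show ?thesis
  proof (intro exI[of _ "nat \<lfloor>t\<rfloor>"] allI impI)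
    fix e :: "nat \<Rightarrow> 'h" and k assume "orthonormal_frame e k"
    then interpret orthonormal_frame e k .
    assume E: "\<forall>i\<le>nat \<lfloor>t\<rfloor>. proj ((f ^^ i) u) = (f ^^ i) u \<and> proj ((op_adjoint f ^^ i) u) = (op_adjoint f ^^ i) u"
    then have "proj u = u" using E[rule_format, of 0] by simp
    then have "power_compression f t u = (f ^^ nat \<lfloor>t\<rfloor>) u"
      "power_compression (op_adjoint f) t u = (op_adjoint f ^^ nat \<lfloor>t\<rfloor>) u"
      using E mop_compress_funpow[OF f, of "nat \<lfloor>t\<rfloor>" u "nat \<lfloor>t\<rfloor>"]
        mop_compress_funpow[OF bounded_clinear_op_adjoint[OF f], of "nat \<lfloor>t\<rfloor>" u "nat \<lfloor>t\<rfloor>"]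
      by (simp_all add: power_compression_int[OF True])
    then show "norm (power_compression f t u - op_power f t u) < \<epsilon> \<and>
        norm (op_adjoint (power_compression f t) u - op_adjoint (op_power f t) u) < \<epsilon>"
      using True \<open>\<epsilon> > 0\<close>
      by (simp add: op_power_def op_adjoint_funpow[OF f] op_adjoint_power_compression_int[OF f True])
  qed
next
  case False
  note pos = t(2)[OF False]
  obtain R where R: "0 \<le> R" "\<And>v. norm (f v) \<le> R * norm v" using bounded_clinear_bound[OF f] by blast
  define \<delta> where "\<delta> = \<epsilon> / (4 * (norm u + 1))"
  have "0 < norm u + 1" by (simp add: add_nonneg_pos)
  then have \<delta>: "\<delta> > 0" "2 * \<delta> * norm u < \<epsilon>"
    using \<open>0 < \<epsilon>\<close> by (simp_all add: \<delta>_def field_simps add_pos_nonneg)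
  obtain Q where Q: "uniform_limit {0..R} (\<lambda>l. poly (Q l)) (\<lambda>s. s powr t) sequentially"
    using polynomials_uniform_limit[OF continuous_on_powr_Icc[OF t(1)]] by blast
  obtain l where "\<forall>s\<in>{0..R}. dist (poly (Q l) s) (s powr t) < \<delta>"
    using eventually_happens[OF uniform_limitD[OF Q \<delta>(1)]] by auto
  then have q: "\<bar>poly (Q l) s - s powr t\<bar> \<le> \<delta>" if "s \<in> {0..R}" for s
    using that by (simp add: dist_real_def less_imp_le)
  define q where "q = Q l"
  note q = q[folded q_def]
  have sa: "op_selfadjoint (op_power f t)"
    using op_selfadjoint_op_cfc[OF f pos R(2,1) continuous_on_powr_Icc[OF t(1)]] False by (simp add: op_power_def)
  show ?thesis
  proof (intro exI[of _ "degree q"] allI impI)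
    fix e :: "nat \<Rightarrow> 'h" and k assume "orthonormal_frame e k"
    then interpret orthonormal_frame e k .
    assume E: "\<forall>i\<le>degree q. proj ((f ^^ i) u) = (f ^^ i) u \<and> proj ((op_adjoint f ^^ i) u) = (op_adjoint f ^^ i) u"
    have "norm (power_compression f t u - op_power f t u) \<le> 2 * \<delta> * norm u"
      by (rule power_compression_approx[OF f pos R(2,1) t(1) False q]) (use E in auto)
    then show "norm (power_compression f t u - op_power f t u) < \<epsilon> \<and>
        norm (op_adjoint (power_compression f t) u - op_adjoint (op_power f t) u) < \<epsilon>"
      using \<delta>(2) op_adjoint_selfadjoint[OF sa]
        op_adjoint_selfadjoint[OF op_selfadjoint_power_compression[OF f pos R(2,1) t(1) False]] by simp
  qed
qed

section \<open>Frames containing given vectors\<close>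

text \<open>Gram-Schmidt: the normalised defect \<open>s - proj s\<close> joins the frame unless it
  is zero, so linear dependence among the vectors does no harm.\<close>

lemma orthonormal_frame_exists:
  fixes S :: "'h::complex_hilbert_space set"
  assumes "finite S"
  shows "\<exists>e k. orthonormal_frame e k \<and> (\<forall>s\<in>S. orthonormal_frame.proj e k s = s)"
  using assms
proof (induction S rule: finite_induct)
  case empty
  have "orthonormal_frame (\<lambda>_. 0 :: 'h) 0" by unfold_locales simp
  then show ?case by blast
next
  case (insert s S)
  then obtain e :: "nat \<Rightarrow> 'h" and k where "orthonormal_frame e k"
    and S: "\<forall>s\<in>S. orthonormal_frame.proj e k s = s" by blast
  then interpret orthonormal_frame e k by blast
  define d where "d = s - proj s"
  show ?case
  proof (cases "d = 0")
    case True
    then show ?thesis using \<open>orthonormal_frame e k\<close> S by (intro exI[of _ e] exI[of _ k]) (simp add: d_def)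
  next
    case False
    define u where "u = inverse (norm d) *\<^sub>R d"
    have pd: "proj d = 0" by (simp add: d_def bounded_clinear_diff[OF bounded_clinear_proj])
    have perp: "cinner w u = 0" if "proj w = w" for w
    proof -
      have "cinner w d = cinner (proj w) d" using that by simp
      then show ?thesis by (simp add: u_def cinner_scaleR_right proj_cinner pd)
    qed
    have uu: "cinner u u = 1" using False
      by (simp add: u_def cinner_scaleR_right cinner_scaleR_left cinner_self power2_eq_square)
    have frame: "orthonormal_frame (e(k := u)) (Suc k)"
    proof
      show "cinner ((e(k := u)) a) ((e(k := u)) b) = (if a = b then 1 else 0)"
        if "a < Suc k" "b < Suc k" for a b
        using that uu ortho[of a b] perp[OF proj_e, of a] perp[OF proj_e, of b] cinner_commute[of u "e b"]
        by (auto simp: less_Suc_eq)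
    qed
    have proj': "orthonormal_frame.proj (e(k := u)) (Suc k) w = proj w + scaleC (cinner w u) u" for w
      by (simp add: orthonormal_frame.proj_def[OF frame] proj_def)
    \<comment> \<open>\<open>proj s\<close> is orthogonal to \<open>d\<close>, so the new
      coefficient of \<open>s\<close> is \<open>norm d\<close> and the enlarged projection restores
      exactly the missing \<open>d\<close>.\<close>
    have "cinner s d = cinner d d + cinner (proj s) d" by (simp add: d_def cinner_diff_left)
    then have "cinner s u = complex_of_real (norm d)"
      using False by (simp add: u_def cinner_scaleR_right proj_cinner pd cinner_self power2_eq_square)
    then have "scaleC (cinner s u) u = d" using False by (simp add: u_def scaleC_of_real)
    then have "\<forall>w\<in>insert s S. orthonormal_frame.proj (e(k := u)) (Suc k) w = w"
      using S perp by (simp add: proj' d_def)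
    then show ?thesis using frame by blast
  qed
qed

section \<open>Convergence of words\<close>

lemma op_word_replicate: "op_word y (replicate i l) = op_letter y l ^^ i"
  by (induction i) simp_all

lemma bounded_clinear_op_letter:
  "bounded_clinear (y (letter_index l)) \<Longrightarrow> bounded_clinear (op_letter y l)"
  by (cases l) (simp_all add: bounded_clinear_op_adjoint)

lemma bounded_clinear_op_word:
  assumes "\<And>l. l \<in> set w \<Longrightarrow> bounded_clinear (y (letter_index l))"
  shows "bounded_clinear (op_word y w)"
  using assms
proof (induction w)
  case Nil
  then show ?case using bounded_clinear_id by (simp add: id_def)
next
  case (Cons l w)
  then show ?case
    using bounded_clinear_compose[of "op_letter y l" "op_word y w"] bounded_clinear_op_letter[of y l]
    by (simp add: o_def)
qed

text \<open>For a word \<open>a # w\<close> the error splits into the letter \<open>A l\<close>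
  applied to the error of \<open>w\<close>, controlled by the uniform bound \<open>C a\<close>, and
  the error of that letter on the fixed vector \<open>op_word y w v\<close>. Convergence of letters
  is thus required only on such vectors.\<close>

lemma op_word_tendsto:
  fixes A :: "nat \<Rightarrow> nat \<Rightarrow> 'h::complex_hilbert_space \<Rightarrow> 'h"
  assumes "\<And>i l. i \<in> I \<Longrightarrow> bounded_clinear (A l i)"
    and "\<And>a l u. letter_index a \<in> I \<Longrightarrow> norm (op_letter (A l) a u) \<le> C a * norm u"
    and "\<And>a w. \<lbrakk>letter_index a \<in> I; letter_index ` set w \<subseteq> I\<rbrakk> \<Longrightarrow>
      (\<lambda>l. op_letter (A l) a (op_word y w v)) \<longlonglongrightarrow> op_letter y a (op_word y w v)"
    and "letter_index ` set w \<subseteq> I"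
  shows "(\<lambda>l. op_word (A l) w v) \<longlonglongrightarrow> op_word y w v"
  using assms(4)
proof (induction w)
  case (Cons a w)
  then have a: "letter_index a \<in> I" and w: "letter_index ` set w \<subseteq> I" by auto
  have "(\<lambda>l. op_letter (A l) a (op_word (A l) w v - op_word y w v)) \<longlonglongrightarrow> 0"
  proof (rule Lim_null_comparison)
    show "\<forall>\<^sub>F l in sequentially. norm (op_letter (A l) a (op_word (A l) w v - op_word y w v))
        \<le> C a * norm (op_word (A l) w v - op_word y w v)"
      using assms(2)[OF a] by simp
    have "(\<lambda>l. op_word (A l) w v - op_word y w v) \<longlonglongrightarrow> 0" using Cons.IH[OF w] by (simp add: LIM_zero)
    then show "(\<lambda>l. C a * norm (op_word (A l) w v - op_word y w v)) \<longlonglongrightarrow> 0"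
      by (intro tendsto_mult_right_zero tendsto_norm_zero)
  qed
  moreover have "bounded_clinear (op_letter (A l) a)" for l
    by (rule bounded_clinear_op_letter, rule assms(1)[OF a])
  ultimately show ?case
    using tendsto_add[OF _ assms(3)[OF a w]] by (fastforce simp: bounded_clinear_diff)
qed simp

text \<open>Complex polarisation: testing on \<open>v + w\<close> and on \<open>v + \<i> w\<close>
  recovers the sesquilinear form from the quadratic one. This is needed because the approximants
  change with the vector being tested.\<close>

lemma op_selfadjointI_real:
  assumes T: "bounded_clinear T" and re: "\<And>v. Im (cinner (T v) v) = 0"
  shows "op_selfadjoint T"
  unfolding op_selfadjoint_def
proof (intro allI)
  fix v w
  have 1: "Im (cinner (T v) w) + Im (cinner (T w) v) = 0"
    using re[of "v + w"] re[of v] re[of w]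
    by (simp add: bounded_clinear_add[OF T] cinner_add_left cinner_add_right)
  have 2: "Re (cinner (T w) v) - Re (cinner (T v) w) = 0"
    using re[of "v + scaleC \<i> w"] re[of v] re[of w]
    by (simp add: bounded_clinear_simps[OF T] cinner_add_left cinner_add_right cinner_scaleC_left
        cinner_scaleC_right)
  have "cinner (T v) w = cnj (cinner (T w) v)" using 1 2 by (simp add: complex_eq_iff)
  then show "cinner (T v) w = cinner v (T w)" using cinner_commute by metis
qed

theorem corollary5p2:
  fixes n m :: nat
    and p :: star_poly
    and t :: "nat \<Rightarrow> real"
    and j :: "nat \<Rightarrow> nat"
    and N D :: "nat set"
    and x :: "nat \<Rightarrow> 'h::complex_hilbert_space \<Rightarrow> 'h"
  assumes "n \<ge> 1" and "m \<ge> 1"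
    and "star_poly_in m p" and "constant_term p = 0"
    and "\<forall>i \<in> {1..m}. t i > 0"
    and "\<forall>i \<in> {1..m}. j i \<in> {1..n}"
    and "N = {r \<in> {1..n}. \<exists>i \<in> {1..m}. j i = r \<and> t i \<notin> \<int>}"
    and "D \<subseteq> {1..n} - N"
    and matrices: "\<forall>k\<ge>1. \<forall>X. admissible_mat n N D k X \<longrightarrow>
           mat_nonneg k (mat_eval k p (\<lambda>i. mat_power k (X (j i)) (t i)))"
    and "admissible_op n N D x"
  shows "op_nonneg (op_eval p (\<lambda>i. op_power (x (j i)) (t i)))"
proof -
  define y where "y i = op_power (x (j i)) (t i)" for i
  have x: "bounded_clinear (x r)" if "r \<in> {1..n}" for r
    using that assms(10) by (simp add: admissible_op_def)
  have t: "t i > 0" and j: "j i \<in> {1..n}" and xj: "bounded_clinear (x (j i))" if "i \<in> {1..m}" for i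
    using that assms(5,6) x by blast+
  have pos: "op_nonneg (x (j i))" if "i \<in> {1..m}" "t i \<notin> \<int>" for i
  proof -
    have "j i \<in> N" using that j assms(7) by blast
    then show ?thesis using assms(10) by (simp add: admissible_op_def)
  qed
  have y: "bounded_clinear (y i)" if "i \<in> {1..m}" for i
    unfolding y_def using that by (intro bounded_clinear_op_power xj t pos)
  have keys: "letter_index ` set w \<subseteq> {1..m}" if "w \<in> Poly_Mapping.keys p" for w
    using that assms(3) by (auto simp: star_poly_in_def)
  have quad: "Im (cinner (op_eval p y v) v) = 0 \<and> 0 \<le> Re (cinner (op_eval p y v) v)" for v
  \<comment> \<open>The hypothesis concerns matrices of size at least 1; a nonzero \<open>v\<close>
    in the span of the frame guarantees that size.\<close>
  proof (cases "v = 0")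
    case False
    define words where "words d l = {w. set w \<subseteq> Var ` {1..d} \<union> VarStar ` {1..d} \<and> length w \<le> l}" for d l :: nat
    have finite_words: "finite (words d l)" for d l
      unfolding words_def by (rule finite_lists_length_le) simp
    have words_iff: "w \<in> words d l \<longleftrightarrow> letter_index ` set w \<subseteq> {1..d} \<and> length w \<le> l" for w d l
    proof -
      have "a \<in> Var ` {1..d} \<union> VarStar ` {1..d} \<longleftrightarrow> letter_index a \<in> {1..d}" for a by (cases a) auto
      then show ?thesis by (auto simp: words_def subset_iff)
    qed
    \<comment> \<open>The inner word, in the powers \<open>y\<close>, produces the vectors at which
      letters must converge. The outer one, in the \<open>x r\<close> and their adjoints, supplies
      the orbits of these vectors. Bounding lengths by \<open>l\<close> keeps the set finite, and
      every such vector is eventually included.\<close>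
    define S where "S l = (\<lambda>(w, w'). op_word x w (op_word y w' v)) ` (words n l \<times> words m l)" for l
    have "\<exists>e k. orthonormal_frame e k \<and> (\<forall>s\<in>S l. orthonormal_frame.proj e k s = s)" for l
      unfolding S_def by (intro orthonormal_frame_exists finite_imageI finite_cartesian_product finite_words)
    then obtain e k where frame: "\<And>l. orthonormal_frame (e l) (k l)"
      and S: "\<And>l s. s \<in> S l \<Longrightarrow> orthonormal_frame.proj (e l) (k l) s = s" by metis
    define A where "A l i = orthonormal_frame.power_compression (e l) (k l) (x (j i)) (t i)" for l i
    have A: "bounded_clinear (A l i)" for l i
      unfolding A_def by (rule orthonormal_frame.bounded_clinear_power_compression[OF frame])
    have "\<exists>C. \<forall>l u. norm (op_letter (A l) a u) \<le> C * norm u" if a: "letter_index a \<in> {1..m}" for a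
    proof -
      obtain C where C: "\<And>l w. norm (A l (letter_index a) w) \<le> C * norm w"
        using power_compression_uniformly_bounded[OF xj[OF a] t[OF a] pos[OF a]] frame
        unfolding A_def by blast
      then show ?thesis using norm_op_adjoint_le[OF A C] by (cases a) auto
    qed
    then obtain C where C: "\<And>a l u. letter_index a \<in> {1..m} \<Longrightarrow> norm (op_letter (A l) a u) \<le> C a * norm u"
      by metis
    have letters: "(\<lambda>l. op_letter (A l) a (op_word y w v)) \<longlonglongrightarrow> op_letter y a (op_word y w v)"
      if a: "letter_index a \<in> {1..m}" and w: "letter_index ` set w \<subseteq> {1..m}" for a w
    proof (rule tendstoI)
      fix \<epsilon> :: real assume "0 < \<epsilon>"
      define i where "i = letter_index a"
      define u where "u = op_word y w v"
      have i: "i \<in> {1..m}" using a by (simp add: i_def)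
      from power_compression_eventually_close[OF xj[OF i] t[OF i] pos[OF i] \<open>0 < \<epsilon>\<close>, of u]
      obtain d where d: "\<And>l. (\<forall>c\<le>d. orthonormal_frame.proj (e l) (k l) ((x (j i) ^^ c) u) = (x (j i) ^^ c) u \<and>
            orthonormal_frame.proj (e l) (k l) ((op_adjoint (x (j i)) ^^ c) u) = (op_adjoint (x (j i)) ^^ c) u) \<Longrightarrow>
          norm (A l i u - y i u) < \<epsilon> \<and> norm (op_adjoint (A l i) u - op_adjoint (y i) u) < \<epsilon>"
        using frame unfolding A_def y_def by blast
      \<comment> \<open>\<open>d\<close> limits the length of the orbits of \<open>u\<close>, and
        \<open>length w\<close> that of the word producing \<open>u\<close>; from their maximum on,
        all these vectors belong to \<open>S l\<close>.\<close>
      have "norm (A l i u - y i u) < \<epsilon> \<and> norm (op_adjoint (A l i) u - op_adjoint (y i) u) < \<epsilon>"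
        if l: "l \<ge> max d (length w)" for l
      proof (rule d, intro allI impI conjI)
        fix c assume c: "c \<le> d"
        have mem: "op_word x (replicate c a') u \<in> S l" if "letter_index a' = j i" for a'
        proof -
          have "replicate c a' \<in> words n l" "w \<in> words m l"
            using l c w j[OF i] that by (auto simp: words_iff)
          then show ?thesis unfolding S_def u_def by (intro image_eqI[of _ _ "(replicate c a', w)"]) auto
        qed
        show "orthonormal_frame.proj (e l) (k l) ((x (j i) ^^ c) u) = (x (j i) ^^ c) u"
          using S[OF mem[of "Var (j i)"]] by (simp add: op_word_replicate)
        show "orthonormal_frame.proj (e l) (k l) ((op_adjoint (x (j i)) ^^ c) u) = (op_adjoint (x (j i)) ^^ c) u"
          using S[OF mem[of "VarStar (j i)"]] by (simp add: op_word_replicate)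
      qed
      then have "dist (op_letter (A l) a u) (op_letter y a u) < \<epsilon>" if "l \<ge> max d (length w)" for l
        using that by (cases a) (auto simp: i_def dist_norm)
      then show "\<forall>\<^sub>F l in sequentially. dist (op_letter (A l) a (op_word y w v)) (op_letter y a (op_word y w v)) < \<epsilon>"
        unfolding eventually_sequentially u_def by blast
    qed
    have "(\<lambda>l. op_word (A l) w v) \<longlonglongrightarrow> op_word y w v" if w: "w \<in> Poly_Mapping.keys p" for w
      by (rule op_word_tendsto[OF A C letters keys[OF w]])
    then have "(\<lambda>l. op_eval p (A l) v) \<longlonglongrightarrow> op_eval p y v"
      unfolding op_eval_def by (intro tendsto_sum tendsto_scaleC)
    then have lim: "(\<lambda>l. cinner (op_eval p (A l) v) v) \<longlonglongrightarrow> cinner (op_eval p y v) v"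
      by (intro tendsto_cinner tendsto_const)
    \<comment> \<open>The tuple of compressions is admissible. As the pair of empty words puts
      \<open>v\<close> into \<open>S l\<close>, the matrix polynomial acts on \<open>v\<close> as
      \<open>op_eval p (A l)\<close>.\<close>
    have nonneg: "Im (cinner (op_eval p (A l) v) v) = 0 \<and> 0 \<le> Re (cinner (op_eval p (A l) v) v)" for l
    proof -
      interpret orthonormal_frame "e l" "k l" by (rule frame)
      have "v \<in> S l" unfolding S_def by (intro image_eqI[of _ _ "([], [])"]) (auto simp: words_iff)
      then have v: "proj v = v" by (rule S)
      have "k l \<noteq> 0"
      proof
        assume "k l = 0"
        then have "proj v = 0" unfolding proj_def by simp
        then show False using v False by simp
      qed
      moreover have "admissible_mat n N D (k l) (\<lambda>r. compress (x r))"
      proof -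
        have "N \<subseteq> {1..n}" using assms(7) by blast
        then show ?thesis
          using assms(10) unfolding admissible_mat_def admissible_op_def
          by (auto simp: mat_selfadjoint_iff_mop mat_nonneg_iff_mop subset_iff
              simp del: atLeastAtMost_iff intro: op_selfadjoint_compress op_nonneg_compress)
      qed
      ultimately have "mat_nonneg (k l) (mat_eval (k l) p (\<lambda>i. mat_power (k l) (compress (x (j i))) (t i)))"
        using matrices[rule_format, of "k l" "\<lambda>r. compress (x r)"] by simp
      moreover have "mop (mat_eval (k l) p (\<lambda>i. mat_power (k l) (compress (x (j i))) (t i))) v = op_eval p (A l) v"
        by (subst mop_mat_eval[OF assms(3)])
          (auto simp: v A_def[abs_def] power_compression_def[abs_def] intro!: mat_power_carrier xj t pos)
      ultimately have "op_nonneg (mop (mat_eval (k l) p (\<lambda>i. mat_power (k l) (compress (x (j i))) (t i))))"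
        by (subst mat_nonneg_iff_mop[symmetric]) (simp_all add: mat_eval_def)
      then show ?thesis
        using \<open>mop _ v = op_eval p (A l) v\<close> op_selfadjoint_cinner_real[of "mop _" v]
        unfolding op_nonneg_def by (metis complex_is_Real_iff)
    qed
    have "(\<lambda>l. Im (cinner (op_eval p (A l) v) v)) \<longlonglongrightarrow> Im (cinner (op_eval p y v) v)"
      "(\<lambda>l. Re (cinner (op_eval p (A l) v) v)) \<longlonglongrightarrow> Re (cinner (op_eval p y v) v)"
      by (intro tendsto_Im tendsto_Re lim)+
    then show ?thesis
      using nonneg by (auto intro: LIMSEQ_le_const simp: LIMSEQ_const_iff)
  qed simp
  have "bounded_clinear (op_eval p y)"
    unfolding op_eval_def
    by (intro bounded_clinear_setsum bounded_clinear_const_scaleC bounded_clinear_op_word y)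
      (use keys in blast)
  then have "op_nonneg (op_eval p y)"
    using quad op_selfadjointI_real by (auto simp: op_nonneg_def)
  then show ?thesis by (simp add: y_def[abs_def])
qed

end
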